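(* Let $\Omega\subset\mathbb{C}^n$ be a bounded hyperconvex domain, let $w_1,\ldots,w_k\in\Omega$ be distinct points, and let $\nu\in[0,\infty)^k$. Suppose that $g_\nu=\varphi_1+\varphi_2$, where $\varphi_1,\varphi_2$ are negative plurisubharmonic functions on $\Omega$. Then there exists $\lambda\in[0,\infty)^k$ such that $\lambda\le\nu$, $\varphi_1=g_\lambda$ and $\varphi_2=g_{\nu-\lambda}$.
   Context: "Negative" means $\le 0$. On $[0,\infty)^k$ the partial order is componentwise: $\mu\le\nu$ iff $\mu_j\le\nu_j$ for $j=1,\ldots,k$. With the poles $w_1,\ldots,w_k$ fixed and $\nu\in[0,\infty)^k$, $g_\nu$ denotes the pluricomplex Green function of $\Omega$ with weight $\nu_j$ at $w_j$: $g_\nu(z)=\sup\{u(z)\}$, the supremum being over all plurisubharmonic functions $u\le 0$ on $\Omega$ such that for each $j$ there is a constant $C_u$ with $u(\zeta)-\nu_j\log|\zeta-w_j|\le C_u$ for $\zeta$ near $w_j$. *)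

theory Defs
  imports "HOL-Analysis.Analysis"
begin

definition usc_on :: "'a::topological_space set \<Rightarrow> ('a \<Rightarrow> ereal) \<Rightarrow> bool" where
  "usc_on S u \<longleftrightarrow> (\<forall>c. openin (top_of_set S) {x \<in> S. u x < c})"

text \<open>
  The Lebesgue mean of \<^term>\<open>u\<close> over the circle of centre \<^term>\<open>c\<close> and radius \<^term>\<open>r\<close>, as the
  integral of the positive part minus that of the negative part (the coercion \<^const>\<open>e2ennreal\<close>
  sends negative values to 0). Where it is used below, \<^term>\<open>u\<close> is upper semicontinuous and
  \<^prop>\<open>u x < (\<infinity>::ereal)\<close>, so that the first integral is finite and the mean is a well-defined value
  below \<^term>\<open>\<infinity> :: ereal\<close>, possibly \<^term>\<open>- \<infinity> :: ereal\<close>.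
\<close>
definition circle_mean :: "(complex \<Rightarrow> ereal) \<Rightarrow> complex \<Rightarrow> real \<Rightarrow> ereal" where
  "circle_mean u c r = ereal (1 / (2 * pi)) *
     (enn2ereal (\<integral>\<^sup>+\<theta>\<in>{0..2 * pi}. e2ennreal (u (c + of_real r * cis \<theta>)) \<partial>lborel) -
      enn2ereal (\<integral>\<^sup>+\<theta>\<in>{0..2 * pi}. e2ennreal (- u (c + of_real r * cis \<theta>)) \<partial>lborel))"

text \<open>
  The function that is identically \<^term>\<open>- \<infinity> :: ereal\<close> counts as subharmonic and as
  plurisubharmonic. Only the restriction of \<^term>\<open>u\<close> to \<^term>\<open>S\<close> matters.
\<close>
definition subharmonic_on :: "complex set \<Rightarrow> (complex \<Rightarrow> ereal) \<Rightarrow> bool" where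
  "subharmonic_on S u \<longleftrightarrow>
     usc_on S u \<and> (\<forall>\<tau>\<in>S. u \<tau> < \<infinity>) \<and>
     (\<forall>c r. 0 < r \<and> cball c r \<subseteq> S \<longrightarrow> u c \<le> circle_mean u c r)"

definition plurisubharmonic_on :: "(complex ^ 'n) set \<Rightarrow> (complex ^ 'n \<Rightarrow> ereal) \<Rightarrow> bool" where
  "plurisubharmonic_on \<Omega> u \<longleftrightarrow>
     usc_on \<Omega> u \<and> (\<forall>z\<in>\<Omega>. u z < \<infinity>) \<and>
     (\<forall>a b. subharmonic_on {\<tau>. a + \<tau> *s b \<in> \<Omega>} (\<lambda>\<tau>. u (a + \<tau> *s b)))"

text \<open>
  A bounded domain is hyperconvex if it has a continuous negative plurisubharmonic exhaustion
  function; the last conjunct says that the sublevel sets are relatively compact in \<^term>\<open>\<Omega>\<close>.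
\<close>
definition bounded_hyperconvex_domain :: "(complex ^ 'n) set \<Rightarrow> bool" where
  "bounded_hyperconvex_domain \<Omega> \<longleftrightarrow>
     open \<Omega> \<and> connected \<Omega> \<and> \<Omega> \<noteq> {} \<and> bounded \<Omega> \<and>
     (\<exists>\<rho> :: complex ^ 'n \<Rightarrow> real.
        continuous_on \<Omega> \<rho> \<and> plurisubharmonic_on \<Omega> (\<lambda>z. ereal (\<rho> z)) \<and> (\<forall>z\<in>\<Omega>. \<rho> z < 0) \<and>
        (\<forall>c<0. compact (closure {z \<in> \<Omega>. \<rho> z < c}) \<and> closure {z \<in> \<Omega>. \<rho> z < c} \<subseteq> \<Omega>))"

text \<open>
  The pole condition is imposed on a punctured neighbourhood of each pole, since
  \<^term>\<open>ln (norm (\<zeta> - w j))\<close> is meaningless at \<^term>\<open>\<zeta> = w j\<close>. For \<^prop>\<open>\<nu> $ j > (0::real)\<close> the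
  sub-mean value property then forces the value \<^term>\<open>- \<infinity> :: ereal\<close> at the pole, and for
  \<^prop>\<open>\<nu> $ j = (0::real)\<close> the condition is void.
\<close>
definition green_class ::
    "(complex ^ 'n) set \<Rightarrow> ('k \<Rightarrow> complex ^ 'n) \<Rightarrow> real ^ 'k \<Rightarrow> (complex ^ 'n \<Rightarrow> ereal) set" where
  "green_class \<Omega> w \<nu> =
     {u. plurisubharmonic_on \<Omega> u \<and> (\<forall>z\<in>\<Omega>. u z \<le> 0) \<and>
         (\<forall>j. \<exists>C :: real. \<forall>\<^sub>F \<zeta> in at (w j).
                u \<zeta> - ereal (\<nu> $ j * ln (norm (\<zeta> - w j))) \<le> ereal C)}"

definition pluricomplex_green ::
    "(complex ^ 'n) set \<Rightarrow> ('k \<Rightarrow> complex ^ 'n) \<Rightarrow> real ^ 'k \<Rightarrow> complex ^ 'n \<Rightarrow> ereal" where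
  "pluricomplex_green \<Omega> w \<nu> z = (SUP u\<in>green_class \<Omega> w \<nu>. u z)"

end

theory Submission
  imports Defs "HOL-Complex_Analysis.Cauchy_Integral_Formula" "HOL-Real_Asymp.Real_Asymp"
begin

text \<open>
  The idea is to read off the weights of the two summands at each pole and then to compare
  both summands with the corresponding Green functions.

  Suppose that weights \<open>\<mu>\<close> with \<open>0 \<le> \<mu> \<le> \<nu>\<close> are found such that \<open>\<phi>\<^sub>1\<close> belongs to the class
  defining the Green function $g_\mu$ and \<open>\<phi>\<^sub>2\<close> to the class defining $g_{\nu-\mu}$. If $u$ is
  any other member of the first class, then $u + \varphi_2$ is a member of the class for \<open>\<nu>\<close>, so
  $u + \varphi_2 \le g_\nu = \varphi_1 + \varphi_2$. Away from the poles $g_\nu$ is finite, because a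
  sum of functions $\nu_j\log(|z-w_j|/D)$ is a competitor; hence \<open>\<phi>\<^sub>2\<close> can be cancelled and
  $u \le \varphi_1$. At the poles the inequality follows from the sub-mean inequality for $u$ and
  the upper semicontinuity of \<open>\<phi>\<^sub>1\<close>. Thus $\varphi_1 = g_\mu$, and $\varphi_2 = g_{\nu-\mu}$ by
  symmetry. This is \<open>green_summand_eq\<close>.

  It remains to find \<open>\<mu>\<close>, one pole $p$ at a time. The maximum principle on annuli shows that
  a competitor with weight $t$ at $p$ satisfies $u \le t\log(|z-p|/R)$ on every closed ball
  of centre $p$ and radius $R$ contained in the domain. Therefore $g_\nu$ has such a bound, and the task is local: if
  $\varphi_1+\varphi_2 \le t\log(|z-p|/R)$, split $t$ into two exponents that bound the summands
  separately (\<open>plurisubharmonic_pole_split\<close>). This is the inequality stating that the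
  Lelong number of a sum is at most the sum of the Lelong numbers. If the maximal exponents \<open>\<mu>\<close> and
  \<open>\<sigma>\<close> of the summands had a sum smaller than $t$, then on each small sphere both summands would
  come close to their upper bounds, at points $a$ and $b$ respectively. On the complex line through
  $a$ and $b$, area means over two nested discs (\<open>plurisubharmonic_two_disc_inequality\<close>) show that
  both are close to their bounds in the mean on a common disc, so that their sum exceeds
  $t\log(|z-p|/R)$ somewhere.
\<close>

section \<open>Upper semicontinuity and circle means of negative functions\<close>

text \<open>
  For functions with values in $[-\infty,0]$ the positive part in
  \<^const>\<open>circle_mean\<close> vanishes, and the sub-mean inequality becomes an upper bound for the
  integral of the nonnegative function \<^term>\<open>- u\<close>, stated in \<^typ>\<open>ennreal\<close>, where values
  $\infty$ need no case distinctions.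
\<close>
lemma sub_mean_iff_nonpos:
  fixes u :: "complex \<Rightarrow> ereal"
  assumes r: "0 \<le> r" and u: "\<And>z. z \<in> sphere c r \<Longrightarrow> u z \<le> 0" and uc: "u c \<le> 0"
  shows "u c \<le> circle_mean u c r \<longleftrightarrow>
    (\<integral>\<^sup>+\<theta>\<in>{0..2 * pi}. e2ennreal (- u (c + of_real r * cis \<theta>)) \<partial>lborel)
      \<le> ennreal (2 * pi) * e2ennreal (- u c)"
proof -
  have on: "c + of_real r * cis \<theta> \<in> sphere c r" for \<theta>
    using r by (simp add: dist_norm norm_mult)
  have p: "(\<integral>\<^sup>+\<theta>\<in>{0..2 * pi}. e2ennreal (u (c + of_real r * cis \<theta>)) \<partial>lborel) = 0"
    using u[OF on] by (simp add: e2ennreal_neg)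
  define I where "I = (\<integral>\<^sup>+\<theta>\<in>{0..2 * pi}. e2ennreal (- u (c + of_real r * cis \<theta>)) \<partial>lborel)"
  have m: "circle_mean u c r = ereal (1 / (2 * pi)) * (0 - enn2ereal I)"
    unfolding circle_mean_def p I_def by (simp add: zero_ennreal.rep_eq)
  have "u c \<le> circle_mean u c r \<longleftrightarrow> I \<le> ennreal (2 * pi) * e2ennreal (- u c)"
  proof (cases I)
    case (real x)
    have m': "circle_mean u c r = ereal (- x / (2 * pi))"
      using real by (simp add: m enn2ereal_ennreal)
    show ?thesis
    proof (cases "u c")
      case (real y)
      then have y: "y \<le> 0" using uc by simp
      have e: "y \<le> - x / (2 * pi) \<longleftrightarrow> x \<le> 2 * pi * (- y)"
        by (subst pos_le_divide_eq) (auto simp: mult.commute)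
      have "ennreal x \<le> ennreal (2 * pi) * ennreal (- y) \<longleftrightarrow> x \<le> 2 * pi * (- y)"
        using y by (subst ennreal_mult [symmetric]) (simp_all add: ennreal_le_iff mult_nonneg_nonpos)
      then show ?thesis using \<open>I = ennreal x\<close> real e by (simp add: m')
    next
      case PInf then show ?thesis using uc by simp
    next
      case MInf then show ?thesis by (simp add: ennreal_mult_top)
    qed
  next
    case top
    then have m': "circle_mean u c r = -\<infinity>" by (simp add: m)
    show ?thesis
    proof (cases "u c")
      case (real y)
      then have "ennreal (2 * pi) * e2ennreal (- u c) \<noteq> top"
        by (simp add: ennreal_mult_eq_top_iff)
      with real m' top show ?thesis by (simp add: top_unique)
    next
      case PInf then show ?thesis using uc by simp
    next
      case MInf then show ?thesis by (simp add: ennreal_mult_top)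
    qed
  qed
  then show ?thesis by (simp add: I_def)
qed

lemma usc_on_compose:
  assumes "usc_on S u" "continuous_on T g" "g ` T \<subseteq> S"
  shows "usc_on T (\<lambda>x. u (g x))"
  unfolding usc_on_def
proof
  fix c
  have "openin (top_of_set S) {x \<in> S. u x < c}" using assms(1) by (simp add: usc_on_def)
  then have "openin (top_of_set T) (T \<inter> g -` {x \<in> S. u x < c})"
    by (intro continuous_openin_preimage[OF assms(2)]) (use assms(3) in auto)
  moreover have "T \<inter> g -` {x \<in> S. u x < c} = {x \<in> T. u (g x) < c}" using assms(3) by auto
  ultimately show "openin (top_of_set T) {x \<in> T. u (g x) < c}" by simp
qed

lemma usc_on_subset: "usc_on S u \<Longrightarrow> T \<subseteq> S \<Longrightarrow> usc_on T u"
  using usc_on_compose[of S u T "\<lambda>x. x"] by simp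

lemma usc_on_iff_eventually:
  "usc_on S u \<longleftrightarrow> (\<forall>x\<in>S. \<forall>c. u x < c \<longrightarrow> (\<forall>\<^sub>F y in at x within S. u y < c))"
proof -
  have "openin (top_of_set S) {x \<in> S. u x < c} \<longleftrightarrow>
      (\<forall>x\<in>S. u x < c \<longrightarrow> (\<forall>\<^sub>F y in at x within S. u y < c))" for c
  proof
    assume o: "openin (top_of_set S) {x \<in> S. u x < c}"
    then obtain T where T: "open T" "{x \<in> S. u x < c} = S \<inter> T" by (auto simp: openin_open)
    show "\<forall>x\<in>S. u x < c \<longrightarrow> (\<forall>\<^sub>F y in at x within S. u y < c)"
      using T unfolding eventually_at_topological by blast
  next
    assume e: "\<forall>x\<in>S. u x < c \<longrightarrow> (\<forall>\<^sub>F y in at x within S. u y < c)"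
    show "openin (top_of_set S) {x \<in> S. u x < c}"
    proof (subst openin_subopen, intro ballI)
      fix x assume x: "x \<in> {x \<in> S. u x < c}"
      then have "\<forall>\<^sub>F y in at x within S. u y < c" using e by blast
      then obtain T where "open T" "x \<in> T" "\<forall>y\<in>T. y \<noteq> x \<longrightarrow> y \<in> S \<longrightarrow> u y < c"
        unfolding eventually_at_topological by blast
      then show "\<exists>T. openin (top_of_set S) T \<and> x \<in> T \<and> T \<subseteq> {x \<in> S. u x < c}"
        using x by (intro exI[of _ "S \<inter> T"]) (auto simp: openin_open)
    qed
  qed
  then show ?thesis unfolding usc_on_def by blast
qed

lemma usc_on_add:
  fixes u v :: "'a::topological_space \<Rightarrow> ereal"
  assumes "usc_on S u" "usc_on S v" and fin: "\<And>x. x \<in> S \<Longrightarrow> u x < \<infinity>" "\<And>x. x \<in> S \<Longrightarrow> v x < \<infinity>"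
  shows "usc_on S (\<lambda>x. u x + v x)"
  unfolding usc_on_iff_eventually
proof (intro ballI allI impI)
  fix x c assume x: "x \<in> S" and c: "u x + v x < c"
  have "\<exists>a b. u x < a \<and> v x < b \<and> a + b \<le> c"
  proof (cases "u x = -\<infinity> \<or> v x = -\<infinity>")
    case False
    then obtain p q where pq: "u x = ereal p" "v x = ereal q"
      using fin[OF x] by (cases "u x"; cases "v x") auto
    then have "ereal (p + q) < c" using c by simp
    then obtain d where d: "p + q < d" "ereal d \<le> c"
      using ereal_dense2[of "ereal (p + q)" c] by (auto intro: less_imp_le)
    show ?thesis
      by (rule exI[of _ "ereal (p + (d - p - q) / 2)"], rule exI[of _ "ereal (q + (d - p - q) / 2)"])
        (use pq d in \<open>auto simp: field_simps\<close>)
  next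
    case True
    have "-\<infinity> < c" using c True fin[OF x] by (cases "u x"; cases "v x") auto
    then obtain d where d: "ereal d \<le> c"
      using ereal_dense2[of "-\<infinity>" c] by (auto intro: less_imp_le)
    from True show ?thesis
    proof
      assume u: "u x = -\<infinity>"
      obtain q where "v x < ereal q" using fin(2)[OF x]
        using ereal_dense2 by blast
      then show ?thesis using u d
        by (intro exI[of _ "ereal (d - q)"] exI[of _ "ereal q"]) auto
    next
      assume v: "v x = -\<infinity>"
      obtain q where "u x < ereal q" using fin(1)[OF x]
        using ereal_dense2 by blast
      then show ?thesis using v d
        by (intro exI[of _ "ereal q"] exI[of _ "ereal (d - q)"]) auto
    qed
  qed
  then obtain a b where ab: "u x < a" "v x < b" "a + b \<le> c" by blast
  have "\<forall>\<^sub>F y in at x within S. u y < a" "\<forall>\<^sub>F y in at x within S. v y < b"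
    using assms(1,2) x ab unfolding usc_on_iff_eventually by blast+
  then show "\<forall>\<^sub>F y in at x within S. u y + v y < c"
    by eventually_elim (meson ab(3) ereal_add_strict_mono2 less_le_trans)
qed

lemma usc_on_borel_measurable:
  fixes u :: "'a::topological_space \<Rightarrow> ereal"
  assumes "usc_on UNIV u"
  shows "u \<in> borel_measurable borel"
  by (rule borel_measurableI_less) (use assms in \<open>auto simp: usc_on_def borel_open\<close>)

lemma subharmonic_circle_measurable:
  assumes "usc_on S u" "sphere c r \<subseteq> S" "0 \<le> r"
  shows "(\<lambda>\<theta>. u (c + of_real r * cis \<theta>)) \<in> borel_measurable borel"
  by (rule usc_on_borel_measurable, rule usc_on_compose[OF assms(1)])
    (use assms(2,3) in \<open>auto intro!: continuous_intros simp: dist_norm norm_mult\<close>)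

section \<open>Circle and disc means of plurisubharmonic functions\<close>

lemma nn_integral_translation:
  fixes f :: "'a::euclidean_space \<Rightarrow> ennreal"
  assumes [measurable]: "f \<in> borel_measurable borel"
  shows "(\<integral>\<^sup>+x. f (c + x) \<partial>lborel) = (\<integral>\<^sup>+x. f x \<partial>lborel)"
proof -
  have "(\<integral>\<^sup>+x. f x \<partial>lborel) = (\<integral>\<^sup>+x. f x \<partial>distr lborel borel ((+) c))"
    by (simp add: lborel_distr_plus)
  also have "\<dots> = (\<integral>\<^sup>+x. f (c + x) \<partial>lborel)" by (subst nn_integral_distr) auto
  finally show ?thesis ..
qed

text \<open>
  Rotation invariance follows from translation invariance alone. Multiply the left-hand side by the
  area of the unit disc, written as an integral over an additional variable \<^term>\<open>s\<close>, and
  translate twice: Fubini then turns the disc around the origin into the disc around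
  \<^term>\<open>s / c\<close>, which has the same area because multiplication by \<^term>\<open>c\<close> is an isometry.
\<close>
lemma nn_integral_complex_rotation:
  fixes f :: "complex \<Rightarrow> ennreal"
  assumes [measurable]: "f \<in> borel_measurable borel" and c: "cmod c = 1"
  shows "(\<integral>\<^sup>+z. f (c * z) \<partial>lborel) = (\<integral>\<^sup>+z. f z \<partial>lborel)"
proof -
  have c0: "c \<noteq> 0" using c by auto
  have [measurable]: "(\<lambda>z. c * z) \<in> borel_measurable borel" for c :: complex
    by (intro borel_measurable_continuous_onI continuous_intros)
  have ind[measurable]: "(\<lambda>x. indicator (ball 0 1) (g x) :: ennreal) \<in> borel_measurable M"
    if [measurable]: "g \<in> borel_measurable M" for g :: "'b \<Rightarrow> complex" and M
    by (rule measurable_compose[OF that borel_measurable_indicator]) simp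
  define V where "V = emeasure lborel (ball (0::complex) 1)"
  have V0: "V \<noteq> 0" "V \<noteq> \<infinity>"
    unfolding V_def by (simp_all add: emeasure_ball eval_unit_ball_vol)
  have vol: "emeasure lborel (ball (a::complex) 1) = V" for a
    unfolding V_def by (simp add: emeasure_ball)
  have "V * (\<integral>\<^sup>+z. f (c * z) \<partial>lborel) =
      (\<integral>\<^sup>+s. indicator (ball (0::complex) 1) s * (\<integral>\<^sup>+z. f (c * z) \<partial>lborel) \<partial>lborel)"
    unfolding V_def by (subst nn_integral_multc) simp_all
  also have "\<dots> = (\<integral>\<^sup>+s. indicator (ball 0 1) s * (\<integral>\<^sup>+z. f (s + c * z) \<partial>lborel) \<partial>lborel)"
  proof (rule nn_integral_cong)
    fix s
    have "(\<integral>\<^sup>+z. f (c * (s / c + z)) \<partial>lborel) = (\<integral>\<^sup>+z. f (c * z) \<partial>lborel)"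
      by (rule nn_integral_translation) measurable
    then show "indicator (ball 0 1) s * (\<integral>\<^sup>+z. f (c * z) \<partial>lborel) = indicator (ball 0 1) s * (\<integral>\<^sup>+z. f (s + c * z) \<partial>lborel)"
      using c0 by (simp add: algebra_simps)
  qed
  also have "\<dots> = (\<integral>\<^sup>+s. (\<integral>\<^sup>+z. indicator (ball 0 1) s * f (s + c * z) \<partial>lborel) \<partial>lborel)"
    by (subst nn_integral_cmult) auto
  also have "\<dots> = (\<integral>\<^sup>+z. (\<integral>\<^sup>+s. indicator (ball 0 1) s * f (s + c * z) \<partial>lborel) \<partial>lborel)"
    by (rule lborel_pair.Fubini') measurable
  also have "\<dots> = (\<integral>\<^sup>+z. (\<integral>\<^sup>+s. indicator (ball 0 1) (s - c * z) * f s \<partial>lborel) \<partial>lborel)"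
  proof (rule nn_integral_cong)
    fix z
    show "(\<integral>\<^sup>+s. indicator (ball 0 1) s * f (s + c * z) \<partial>lborel) = (\<integral>\<^sup>+s. indicator (ball 0 1) (s - c * z) * f s \<partial>lborel)"
      using nn_integral_translation[of "\<lambda>s. indicator (ball 0 1) (s - c * z) * f s" "c * z"]
      by (simp add: add.commute)
  qed
  also have "\<dots> = (\<integral>\<^sup>+s. (\<integral>\<^sup>+z. indicator (ball 0 1) (s - c * z) * f s \<partial>lborel) \<partial>lborel)"
    by (rule lborel_pair.Fubini') measurable
  also have "\<dots> = (\<integral>\<^sup>+s. V * f s \<partial>lborel)"
  proof (rule nn_integral_cong)
    fix s
    have "cmod (s - c * z) = cmod (s / c - z)" for z
    proof -
      have "s - c * z = c * (s / c - z)" using c0 by (simp add: field_simps)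
      then show ?thesis by (metis c mult_1 norm_mult)
    qed
    then have "s - c * z \<in> ball 0 1 \<longleftrightarrow> z \<in> ball (s / c) 1" for z
      by (metis dist_norm mem_ball mem_ball_0)
    then have "indicator (ball 0 1) (s - c * z) = (indicator (ball (s / c) 1) z :: ennreal)" for z
      by (simp add: indicator_def)
    then show "(\<integral>\<^sup>+z. indicator (ball 0 1) (s - c * z) * f s \<partial>lborel) = V * f s"
      by (simp only:) (subst nn_integral_multc, simp_all add: vol borel_measurable_indicator)
  qed
  also have "\<dots> = V * (\<integral>\<^sup>+s. f s \<partial>lborel)" by (rule nn_integral_cmult) measurable
  finally show ?thesis using V0 by (metis ennreal_mult_cancel_left infinity_ennreal_def)
qed

text \<open>
  If no point were a maximum, the relatively open sets on which \<^term>\<open>f\<close> stays below the value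
  \<^term>\<open>f y\<close>, for \<^term>\<open>y\<close> in \<^term>\<open>K\<close>, would cover \<^term>\<open>K\<close>; in a finite subcover the
  \<^term>\<open>y\<close> with the largest value is not covered.
\<close>
lemma usc_on_attains_max:
  fixes f :: "'a::topological_space \<Rightarrow> ereal"
  assumes K: "compact K" "K \<noteq> {}" and f: "usc_on K f"
  obtains x where "x \<in> K" "\<And>y. y \<in> K \<Longrightarrow> f y \<le> f x"
proof -
  have "\<exists>x\<in>K. \<forall>y\<in>K. f y \<le> f x"
  proof (rule ccontr)
    assume "\<not> ?thesis"
    then have ex: "\<forall>x\<in>K. \<exists>y\<in>K. f x < f y" by (auto simp: not_le)
    define C where "C = (\<lambda>y. {x \<in> K. f x < f y}) ` K"
    have "\<forall>c\<in>C. openin (top_of_set K) c" "K \<subseteq> \<Union>C"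
      using f ex by (auto simp: C_def usc_on_def)
    then obtain D where D: "D \<subseteq> C" "finite D" "K \<subseteq> \<Union>D"
      using K(1)[unfolded compact_eq_openin_cover, rule_format, of C] by blast
    then obtain Y where Y: "Y \<subseteq> K" "finite Y" "D = (\<lambda>y. {x \<in> K. f x < f y}) ` Y"
      using finite_subset_image[OF D(2) D(1)[unfolded C_def]] by blast
    have "Y \<noteq> {}" using D(3) Y(3) K(2) by auto
    then have "Max (f ` Y) \<in> f ` Y" using Y(2) by (intro Max_in) auto
    then obtain y where y: "y \<in> Y" "f y = Max (f ` Y)" by auto
    then have "y \<in> \<Union>D" using Y(1) D(3) by blast
    then obtain y' where y': "y' \<in> Y" "f y < f y'" using Y(3) by auto
    then have "f y' \<le> f y" using y(2) Y(2) by simp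
    then show False using y'(2) by simp
  qed
  then show ?thesis using that by blast
qed

lemma plurisubharmonic_circle_bound:
  assumes u: "plurisubharmonic_on \<Omega> u" and neg: "\<And>z. z \<in> \<Omega> \<Longrightarrow> u z \<le> 0"
    and sub: "\<And>\<tau>. cmod \<tau> \<le> 1 \<Longrightarrow> a + \<tau> *s b \<in> \<Omega>"
  shows "(\<integral>\<^sup>+\<theta>\<in>{0..2 * pi}. e2ennreal (- u (a + cis \<theta> *s b)) \<partial>lborel) \<le> ennreal (2 * pi) * e2ennreal (- u a)"
proof -
  have s: "subharmonic_on {\<tau>. a + \<tau> *s b \<in> \<Omega>} (\<lambda>\<tau>. u (a + \<tau> *s b))"
    using u by (simp add: plurisubharmonic_on_def)
  have "cball 0 1 \<subseteq> {\<tau>. a + \<tau> *s b \<in> \<Omega>}" using sub by auto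
  moreover have "\<forall>c r. 0 < r \<and> cball c r \<subseteq> {\<tau>. a + \<tau> *s b \<in> \<Omega>} \<longrightarrow>
      u (a + c *s b) \<le> circle_mean (\<lambda>\<tau>. u (a + \<tau> *s b)) c r"
    using s by (simp add: subharmonic_on_def)
  ultimately have "u (a + 0 *s b) \<le> circle_mean (\<lambda>\<tau>. u (a + \<tau> *s b)) 0 1"
    by (metis zero_less_one)
  moreover have "u (a + \<tau> *s b) \<le> 0" if "\<tau> \<in> sphere 0 1 \<or> \<tau> = 0" for \<tau>
    using sub[of \<tau>] neg that by auto
  ultimately show ?thesis
    using sub_mean_iff_nonpos[of 1 0 "\<lambda>\<tau>. u (a + \<tau> *s b)"] sub[of 0] neg by simp
qed

lemma plurisubharmonic_disc_measurable:
  fixes u :: "complex ^ 'n \<Rightarrow> ereal"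
  assumes u: "plurisubharmonic_on \<Omega> u" and sub: "\<And>\<tau>. cmod (\<tau> - c) < R \<Longrightarrow> a + \<tau> *s b \<in> \<Omega>"
  shows "(\<lambda>\<tau>. e2ennreal (- u (a + \<tau> *s b)) * indicator (ball c R) \<tau>) \<in> borel_measurable borel"
proof -
  have "usc_on {\<tau>. a + \<tau> *s b \<in> \<Omega>} (\<lambda>\<tau>. u (a + \<tau> *s b))"
    using u by (simp add: plurisubharmonic_on_def subharmonic_on_def)
  moreover have "ball c R \<subseteq> {\<tau>. a + \<tau> *s b \<in> \<Omega>}" using sub by (auto simp: dist_norm norm_minus_commute)
  ultimately have "usc_on (ball c R) (\<lambda>\<tau>. u (a + \<tau> *s b))" by (rule usc_on_subset)
  then have o: "open {\<tau> \<in> ball c R. u (a + \<tau> *s b) < y}" for y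
    unfolding usc_on_def by (simp add: openin_open_eq)
  have "(\<lambda>\<tau>. if \<tau> \<in> ball c R then u (a + \<tau> *s b) else \<infinity>) \<in> borel_measurable borel"
  proof (rule borel_measurableI_less)
    fix y :: ereal
    have "{\<tau> \<in> space borel. (if \<tau> \<in> ball c R then u (a + \<tau> *s b) else \<infinity>) < y} = {\<tau> \<in> ball c R. u (a + \<tau> *s b) < y}"
      by auto
    then show "{\<tau> \<in> space borel. (if \<tau> \<in> ball c R then u (a + \<tau> *s b) else \<infinity>) < y} \<in> sets borel"
      using o by (simp add: borel_open)
  qed
  then have "(\<lambda>\<tau>. e2ennreal (- (if \<tau> \<in> ball c R then u (a + \<tau> *s b) else \<infinity>))) \<in> borel_measurable borel"
    by measurable
  moreover have "e2ennreal (- (if \<tau> \<in> ball c R then u (a + \<tau> *s b) else \<infinity>)) = e2ennreal (- u (a + \<tau> *s b)) * indicator (ball c R) \<tau>" for \<tau>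
    by (auto simp: e2ennreal_neg)
  ultimately show ?thesis by simp
qed

text \<open>
  Integrating the circle inequality over all rotations of the disc gives the inequality for area
  means. For a point \<^term>\<open>\<tau>\<close> of the disc, the circle through \<^term>\<open>\<tau>\<close> is parametrised starting
  at \<^term>\<open>\<tau>\<close> itself; this is the unit circle of the complex line in the direction
  \<^term>\<open>\<tau> *s b\<close>, so no change of the starting angle is needed.
\<close>
lemma plurisubharmonic_disc_bound:
  fixes u :: "complex ^ 'n \<Rightarrow> ereal"
  assumes u: "plurisubharmonic_on \<Omega> u" and neg: "\<And>z. z \<in> \<Omega> \<Longrightarrow> u z \<le> 0"
    and sub: "\<And>\<tau>. cmod (\<tau> - c) < R \<Longrightarrow> a + \<tau> *s b \<in> \<Omega>"
  shows "(\<integral>\<^sup>+\<tau>\<in>ball c R. e2ennreal (- u (a + \<tau> *s b)) \<partial>lborel)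
    \<le> emeasure lborel (ball c R) * e2ennreal (- u (a + c *s b))"
proof -
  define F where "F \<tau> = e2ennreal (- u (a + \<tau> *s b)) * indicator (ball c R) \<tau>" for \<tau>
  have F[measurable]: "F \<in> borel_measurable borel"
    unfolding F_def using u sub by (rule plurisubharmonic_disc_measurable)
  have cis[measurable]: "cis \<in> borel_measurable borel"
    by (intro borel_measurable_continuous_onI continuous_intros)
  have rot: "(\<integral>\<^sup>+\<tau>. F (c + cis \<theta> * \<tau>) \<partial>lborel) = (\<integral>\<^sup>+z. F z \<partial>lborel)" for \<theta>
    using nn_integral_complex_rotation[of "\<lambda>\<tau>. F (c + \<tau>)" "cis \<theta>"] nn_integral_translation[of F c] by simp
  have "ennreal (2 * pi) * (\<integral>\<^sup>+z. F z \<partial>lborel) = (\<integral>\<^sup>+\<theta>. indicator {0..2 * pi} \<theta> * (\<integral>\<^sup>+z. F z \<partial>lborel) \<partial>lborel)"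
    by (subst nn_integral_multc) auto
  also have "\<dots> = (\<integral>\<^sup>+\<theta>. indicator {0..2 * pi} \<theta> * (\<integral>\<^sup>+\<tau>. F (c + cis \<theta> * \<tau>) \<partial>lborel) \<partial>lborel)"
    by (simp add: rot)
  also have "\<dots> = (\<integral>\<^sup>+\<theta>. (\<integral>\<^sup>+\<tau>. indicator {0..2 * pi} \<theta> * F (c + cis \<theta> * \<tau>) \<partial>lborel) \<partial>lborel)"
    by (subst nn_integral_cmult) auto
  also have "\<dots> = (\<integral>\<^sup>+\<tau>. (\<integral>\<^sup>+\<theta>. indicator {0..2 * pi} \<theta> * F (c + cis \<theta> * \<tau>) \<partial>lborel) \<partial>lborel)"
    by (rule lborel_pair.Fubini') measurable
  also have "\<dots> \<le> (\<integral>\<^sup>+\<tau>. ennreal (2 * pi) * e2ennreal (- u (a + c *s b)) * indicator (ball (0::complex) R) \<tau> \<partial>lborel)"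
  proof (rule nn_integral_mono)
    fix \<tau> :: complex
    show "(\<integral>\<^sup>+\<theta>. indicator {0..2 * pi} \<theta> * F (c + cis \<theta> * \<tau>) \<partial>lborel)
      \<le> ennreal (2 * pi) * e2ennreal (- u (a + c *s b)) * indicator (ball 0 R) \<tau>"
    proof (cases "\<tau> \<in> ball 0 R")
      case False
      then have "F (c + cis \<theta> * \<tau>) = 0" for \<theta> by (simp add: F_def dist_norm norm_mult)
      then show ?thesis by simp
    next
      case True
      have e: "a + (c + x * \<tau>) *s b = (a + c *s b) + x *s (\<tau> *s b)" for x
        by (simp add: vector_sadd_rdistrib vector_smult_assoc)
      have "(\<integral>\<^sup>+\<theta>\<in>{0..2 * pi}. e2ennreal (- u ((a + c *s b) + cis \<theta> *s (\<tau> *s b))) \<partial>lborel)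
        \<le> ennreal (2 * pi) * e2ennreal (- u (a + c *s b))"
      proof (rule plurisubharmonic_circle_bound[OF u neg])
        fix x :: complex assume "cmod x \<le> 1"
        then have "cmod (x * \<tau>) < R" using True
          using mult_left_le_one_le[of "cmod \<tau>" "cmod x"] by (simp add: norm_mult)
        then show "(a + c *s b) + x *s (\<tau> *s b) \<in> \<Omega>"
          using sub[of "c + x * \<tau>"] by (simp add: e add.assoc)
      qed auto
      moreover have "F (c + cis \<theta> * \<tau>) = e2ennreal (- u ((a + c *s b) + cis \<theta> *s (\<tau> *s b)))" for \<theta>
        using True by (simp add: F_def e add.assoc dist_norm norm_mult)
      ultimately show ?thesis using True by (simp add: mult.commute)
    qed
  qed
  also have "\<dots> = ennreal (2 * pi) * (emeasure lborel (ball c R) * e2ennreal (- u (a + c *s b)))"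
  proof -
    have "emeasure lborel (ball 0 R :: complex set) = emeasure lborel (ball c R)"
      by (cases "R \<ge> 0") (simp_all add: emeasure_ball ball_empty)
    then show ?thesis by (subst nn_integral_cmult_indicator) (simp_all add: mult_ac)
  qed
  finally show ?thesis
    unfolding F_def by (subst (asm) ennreal_mult_le_mult_iff) auto
qed

text \<open>
  The sub-mean inequality in the form in which it is applied: a continuous real majorant on the
  circle, whose integral is known, bounds the value at the centre. The majorant may take positive
  values, and only its negative part is compared with \<^term>\<open>- u\<close>.
\<close>
lemma plurisubharmonic_mean_le:
  assumes u: "plurisubharmonic_on \<Omega> u" and neg: "\<And>z. z \<in> \<Omega> \<Longrightarrow> u z \<le> 0"
    and sub: "\<And>\<tau>. cmod \<tau> \<le> 1 \<Longrightarrow> a + \<tau> *s b \<in> \<Omega>"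
    and le: "\<And>\<theta>. \<theta> \<in> {0..2 * pi} \<Longrightarrow> u (a + cis \<theta> *s b) \<le> ereal (q \<theta>)"
    and q: "(q has_integral J) {0..2 * pi}" "continuous_on {0..2 * pi} q"
  shows "u a \<le> ereal (J / (2 * pi))"
proof -
  define h where "h \<theta> = max 0 (- q \<theta>)" for \<theta>
  have "continuous_on {0..2 * pi} h" unfolding h_def by (intro continuous_intros q)
  then have "h integrable_on {0..2 * pi}" by (rule integrable_continuous_interval)
  then have hI: "(h has_integral (integral {0..2 * pi} h)) {0..2 * pi}" by (rule integrable_integral)
  have JI: "- J \<le> integral {0..2 * pi} h"
    by (rule has_integral_le[OF has_integral_neg[OF q(1)] hI]) (simp add: h_def)
  have ua: "u a \<le> 0" using sub[of 0] neg by simp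
  have "ennreal (integral {0..2 * pi} h) = (\<integral>\<^sup>+\<theta>. indicator {0..2 * pi} \<theta> * ennreal (h \<theta>) \<partial>lborel)"
    using nn_integral_has_integral_lebesgue[OF _ hI] by (simp add: h_def ennreal_mult' ennreal_indicator)
  also have "\<dots> \<le> (\<integral>\<^sup>+\<theta>\<in>{0..2 * pi}. e2ennreal (- u (a + cis \<theta> *s b)) \<partial>lborel)"
  proof (rule nn_integral_mono)
    fix \<theta>
    have "ennreal (h \<theta>) \<le> e2ennreal (- u (a + cis \<theta> *s b))" if "\<theta> \<in> {0..2 * pi}"
    proof -
      have "ereal (- q \<theta>) \<le> - u (a + cis \<theta> *s b)"
        using le[OF that] by (metis ereal_minus_le_minus uminus_ereal.simps(1))
      then have "ennreal (- q \<theta>) \<le> e2ennreal (- u (a + cis \<theta> *s b))"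
        using e2ennreal_mono by fastforce
      then show ?thesis by (simp add: h_def max_def ennreal_neg)
    qed
    then show "indicator {0..2 * pi} \<theta> * ennreal (h \<theta>) \<le> e2ennreal (- u (a + cis \<theta> *s b)) * indicator {0..2 * pi} \<theta>"
      by (auto simp: indicator_def)
  qed
  also have "\<dots> \<le> ennreal (2 * pi) * e2ennreal (- u a)"
    by (rule plurisubharmonic_circle_bound[OF u neg sub])
  finally have *: "ennreal (integral {0..2 * pi} h) \<le> ennreal (2 * pi) * e2ennreal (- u a)" .
  show ?thesis
  proof (cases "u a")
    case (real y)
    have "ennreal (integral {0..2 * pi} h) \<le> ennreal (2 * pi * (- y))"
      using * real ennreal_mult'[of "2 * pi" "- y"] by simp
    moreover have "0 \<le> 2 * pi * (- y)" using real ua by (simp add: mult_nonneg_nonpos)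
    ultimately have "integral {0..2 * pi} h \<le> 2 * pi * (- y)" by (simp add: ennreal_le_iff)
    then have "2 * pi * y \<le> J" using JI by simp
    then show ?thesis using real by (simp add: field_simps)
  qed (use ua in auto)
qed

section \<open>Jensen's inequality\<close>

text \<open>
  The harmonic mean value property of $\log|\cdot|$ away from its pole, from Cauchy's formula for
  the holomorphic function $\mathrm{Ln}(1+qz)$, with \<^term>\<open>q = \<beta> / \<alpha>\<close>, at the origin.
\<close>
lemma has_integral_ln_norm_circle:
  fixes \<alpha> \<beta> :: complex
  assumes "cmod \<beta> < cmod \<alpha>"
  shows "((\<lambda>\<theta>. ln (cmod (\<alpha> + cis \<theta> * \<beta>))) has_integral 2 * pi * ln (cmod \<alpha>)) {0..2 * pi}"
proof -
  have \<alpha>: "\<alpha> \<noteq> 0" using assms by auto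
  define q where "q = \<beta> / \<alpha>"
  have q: "cmod q < 1" using assms \<alpha> by (simp add: q_def norm_divide divide_less_eq)
  have re: "0 < Re (1 + q * z)" if "cmod z \<le> 1" for z
  proof -
    have "cmod (q * z) < 1" using q that
      using mult_right_le_one_le[of "cmod q" "cmod z"] by (simp add: norm_mult)
    then have "\<bar>Re (q * z)\<bar> < 1" using abs_Re_le_cmod[of "q * z"] by linarith
    then show ?thesis by simp
  qed
  have "(\<lambda>z. Ln (1 + q * z)) holomorphic_on cball 0 1"
    by (intro holomorphic_intros) (use re in \<open>force simp: complex_nonpos_Reals_iff\<close>)
  then have "((\<lambda>z. Ln (1 + q * z) / (z - 0)) has_contour_integral (2 * of_real pi * \<i> * Ln (1 + q * 0)))
      (circlepath 0 1)"
    by (rule Cauchy_integral_circlepath_simple) simp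
  then have "((\<lambda>\<theta>. Ln (1 + q * (0 + 1 * cis \<theta>)) / (0 + 1 * cis \<theta> - 0) * 1 * \<i> * cis \<theta>) has_integral 0) {0..2 * pi}"
    unfolding circlepath_def using has_contour_integral_part_circlepath_iff[of 0 "2 * pi" _ _ 0 1] by simp
  then have "((\<lambda>\<theta>. \<i> * Ln (1 + q * cis \<theta>)) has_integral 0) {0..2 * pi}"
    by (simp add: mult.commute)
  then have "((\<lambda>\<theta>. - \<i> * (\<i> * Ln (1 + q * cis \<theta>))) has_integral - \<i> * 0) {0..2 * pi}"
    by (rule has_integral_mult_right)
  then have "((\<lambda>\<theta>. Ln (1 + q * cis \<theta>)) has_integral 0) {0..2 * pi}" by simp
  then have "((Re \<circ> (\<lambda>\<theta>. Ln (1 + q * cis \<theta>))) has_integral Re 0) {0..2 * pi}"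
    by (rule has_integral_linear) (rule bounded_linear_Re)
  then have "((\<lambda>\<theta>. Re (Ln (1 + q * cis \<theta>))) has_integral 0) {0..2 * pi}" by (simp add: o_def)
  moreover have "((\<lambda>\<theta>. ln (cmod \<alpha>)) has_integral 2 * pi * ln (cmod \<alpha>)) {0..2 * pi}"
    using has_integral_const_real[of "ln (cmod \<alpha>)" 0 "2 * pi"] by simp
  ultimately have "((\<lambda>\<theta>. Re (Ln (1 + q * cis \<theta>)) + ln (cmod \<alpha>)) has_integral 0 + 2 * pi * ln (cmod \<alpha>)) {0..2 * pi}"
    by (rule has_integral_add)
  moreover have "Re (Ln (1 + q * cis \<theta>)) + ln (cmod \<alpha>) = ln (cmod (\<alpha> + cis \<theta> * \<beta>))" for \<theta>
  proof -
    have nz: "1 + q * cis \<theta> \<noteq> 0" using re[of "cis \<theta>"] by (metis norm_cis order_refl zero_complex.sel(1) less_irrefl)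
    have "\<alpha> + cis \<theta> * \<beta> = (1 + q * cis \<theta>) * \<alpha>" using \<alpha> by (simp add: q_def field_simps)
    then show ?thesis using nz \<alpha> by (simp add: norm_mult ln_mult)
  qed
  ultimately show ?thesis by simp
qed

lemma nn_integral_ln_circle_inside:
  fixes \<alpha> \<beta> :: complex
  assumes lt: "cmod \<beta> < cmod \<alpha>" and t: "0 < t" and D: "0 < D"
    and le: "\<And>\<theta>. cmod (\<alpha> + cis \<theta> * \<beta>) \<le> D"
  shows "(\<integral>\<^sup>+\<theta>\<in>{0..2 * pi}. ennreal (t * ln (D / cmod (\<alpha> + cis \<theta> * \<beta>))) \<partial>lborel)
    = ennreal (2 * pi * t * ln (D / cmod \<alpha>))"
proof -
  have \<alpha>: "\<alpha> \<noteq> 0" using lt by auto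
  have nz: "\<alpha> + cis \<theta> * \<beta> \<noteq> 0" for \<theta>
  proof
    assume "\<alpha> + cis \<theta> * \<beta> = 0"
    then have "\<alpha> = - (cis \<theta> * \<beta>)" by (simp add: eq_neg_iff_add_eq_0)
    then have "cmod \<alpha> = cmod \<beta>" by (simp add: norm_mult)
    then show False using lt by simp
  qed
  have "((\<lambda>\<theta>. ln D) has_integral 2 * pi * ln D) {0..2 * pi}"
    using has_integral_const_real[of "ln D" 0 "2 * pi"] by simp
  from has_integral_diff[OF this has_integral_ln_norm_circle[OF lt]]
  have "((\<lambda>\<theta>. t * (ln D - ln (cmod (\<alpha> + cis \<theta> * \<beta>)))) has_integral t * (2 * pi * ln D - 2 * pi * ln (cmod \<alpha>))) {0..2 * pi}"
    by (rule has_integral_mult_right)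
  moreover have "t * (2 * pi * ln D - 2 * pi * ln (cmod \<alpha>)) = 2 * pi * t * ln (D / cmod \<alpha>)"
    using D \<alpha> by (simp add: ln_div algebra_simps)
  moreover have "t * (ln D - ln (cmod (\<alpha> + cis \<theta> * \<beta>))) = t * ln (D / cmod (\<alpha> + cis \<theta> * \<beta>))" for \<theta>
    using D nz by (simp add: ln_div)
  ultimately have I: "((\<lambda>\<theta>. t * ln (D / cmod (\<alpha> + cis \<theta> * \<beta>))) has_integral 2 * pi * t * ln (D / cmod \<alpha>)) {0..2 * pi}"
    by simp
  have pos: "0 \<le> t * ln (D / cmod (\<alpha> + cis \<theta> * \<beta>))" for \<theta>
    using t nz le[of \<theta>] by (intro mult_nonneg_nonneg ln_ge_zero) (auto simp: le_divide_eq)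
  show ?thesis
    using nn_integral_has_integral_lebesgue[OF pos I] pos
    by (simp add: ennreal_mult' ennreal_indicator mult.commute)
qed

text \<open>
  Jensen's inequality for an affine function that may have a zero. If the zero lies inside the
  circle, then $|\alpha + e^{i\theta}\beta| = |\bar\beta + e^{i\theta}\bar\alpha|$ exchanges the two
  coefficients and reduces to the case without zeros. If the zero lies on the circle, \<^term>\<open>\<beta>\<close>
  is approximated by \<^term>\<open>\<rho> * \<beta>\<close> with real \<^term>\<open>\<rho> < 1\<close>, and Fatou's lemma applies.
\<close>
lemma nn_integral_ln_circle_le:
  fixes \<alpha> \<beta> :: complex
  assumes \<alpha>: "\<alpha> \<noteq> 0" and t: "0 < t" and D: "0 < D"
    and le: "\<And>\<theta>. cmod (\<alpha> + cis \<theta> * \<beta>) \<le> D"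
  shows "(\<integral>\<^sup>+\<theta>\<in>{0..2 * pi}. (if \<alpha> + cis \<theta> * \<beta> = 0 then top else ennreal (t * ln (D / cmod (\<alpha> + cis \<theta> * \<beta>)))) \<partial>lborel)
    \<le> ennreal (2 * pi * t * ln (D / cmod \<alpha>))"
proof -
  have nz: "\<alpha> + cis \<theta> * \<beta> \<noteq> 0" if "cmod \<alpha> \<noteq> cmod \<beta>" for \<theta>
  proof
    assume "\<alpha> + cis \<theta> * \<beta> = 0"
    then have "\<alpha> = - (cis \<theta> * \<beta>)" by (simp add: eq_neg_iff_add_eq_0)
    then have "cmod \<alpha> = cmod \<beta>" by (simp add: norm_mult)
    then show False using that by simp
  qed
  consider "cmod \<beta> < cmod \<alpha>" | "cmod \<alpha> < cmod \<beta>" | "cmod \<beta> = cmod \<alpha>" by linarith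
  then show ?thesis
  proof cases
    case 1
    then show ?thesis using nn_integral_ln_circle_inside[OF 1 t D le] nz by simp
  next
    case 2
    have sw: "cmod (\<alpha> + cis \<theta> * \<beta>) = cmod (cnj \<beta> + cis \<theta> * cnj \<alpha>)" for \<theta>
    proof -
      have "cis \<theta> * cnj (cis \<theta>) = 1" by (simp add: cis_cnj cis_mult)
      then have "cnj \<beta> + cis \<theta> * cnj \<alpha> = cis \<theta> * cnj \<alpha> + (cis \<theta> * cnj (cis \<theta>)) * cnj \<beta>" by simp
      also have "\<dots> = cis \<theta> * cnj (\<alpha> + cis \<theta> * \<beta>)" by (simp add: distrib_left mult.assoc)
      finally have "cmod (cnj \<beta> + cis \<theta> * cnj \<alpha>) = cmod (cis \<theta>) * cmod (cnj (\<alpha> + cis \<theta> * \<beta>))"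
        by (simp only: norm_mult)
      then show ?thesis by (simp only: complex_mod_cnj norm_cis mult_1)
    qed
    have "(\<integral>\<^sup>+\<theta>\<in>{0..2 * pi}. ennreal (t * ln (D / cmod (cnj \<beta> + cis \<theta> * cnj \<alpha>))) \<partial>lborel)
        = ennreal (2 * pi * t * ln (D / cmod (cnj \<beta>)))"
      by (rule nn_integral_ln_circle_inside) (use 2 t D le sw in auto)
    moreover have "ln (D / cmod \<beta>) \<le> ln (D / cmod \<alpha>)"
      using 2 \<alpha> D by (subst ln_le_cancel_iff) (auto intro!: divide_left_mono divide_pos_pos mult_pos_pos)
    ultimately show ?thesis using 2 nz t
      by (simp add: sw[symmetric] ennreal_leI mult_left_mono)
  next
    case 3
    define \<rho> where "\<rho> k = (real k + 1) / (real k + 2)" for k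
    have \<rho>: "0 < \<rho> k" "\<rho> k < 1" for k by (auto simp: \<rho>_def)
    have \<rho>lim: "\<rho> \<longlonglongrightarrow> 1" unfolding \<rho>_def by real_asymp
    have \<alpha>D: "cmod \<alpha> \<le> D"
    proof -
      have "\<alpha> = ((\<alpha> + cis 0 * \<beta>) + (\<alpha> + cis pi * \<beta>)) / 2" by simp
      then have "cmod \<alpha> \<le> (cmod (\<alpha> + cis 0 * \<beta>) + cmod (\<alpha> + cis pi * \<beta>)) / 2"
        by (metis divide_right_mono norm_divide norm_numeral norm_triangle_ineq zero_le_numeral)
      also have "\<dots> \<le> (D + D) / 2"
        by (intro divide_right_mono add_mono le) simp
      finally show ?thesis by simp
    qed
    define z where "z k \<theta> = \<alpha> + cis \<theta> * (\<rho> k * \<beta>)" for k \<theta>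
    have zD: "cmod (z k \<theta>) \<le> D" for k \<theta>
    proof -
      have "z k \<theta> = of_real (1 - \<rho> k) * \<alpha> + of_real (\<rho> k) * (\<alpha> + cis \<theta> * \<beta>)"
        by (simp add: z_def algebra_simps)
      then have "cmod (z k \<theta>) \<le> cmod (of_real (1 - \<rho> k) * \<alpha>) + cmod (of_real (\<rho> k) * (\<alpha> + cis \<theta> * \<beta>))"
        by (metis norm_triangle_ineq)
      also have "\<dots> = (1 - \<rho> k) * cmod \<alpha> + \<rho> k * cmod (\<alpha> + cis \<theta> * \<beta>)"
        using \<rho>[of k] by (simp only: norm_mult norm_of_real)
      also have "\<dots> \<le> (1 - \<rho> k) * D + \<rho> k * D"
        using \<rho>[of k] \<alpha>D le[of \<theta>] by (intro add_mono mult_left_mono) auto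
      finally show ?thesis by (simp add: algebra_simps)
    qed
    define g where "g k \<theta> = ennreal (t * ln (D / cmod (z k \<theta>))) * indicator {0..2 * pi} \<theta>" for k \<theta>
    have [measurable]: "cis \<in> borel_measurable borel"
      by (intro borel_measurable_continuous_onI continuous_intros)
    have gm: "g k \<in> borel_measurable lborel" for k unfolding g_def z_def by measurable
    have gI: "(\<integral>\<^sup>+\<theta>. g k \<theta> \<partial>lborel) = ennreal (2 * pi * t * ln (D / cmod \<alpha>))" for k
      unfolding g_def z_def
    proof (rule nn_integral_ln_circle_inside)
      show "cmod (of_real (\<rho> k) * \<beta>) < cmod \<alpha>" using 3 \<rho>[of k] \<alpha> by (simp add: norm_mult)
      show "cmod (\<alpha> + cis \<theta> * (of_real (\<rho> k) * \<beta>)) \<le> D" for \<theta> using zD[of k \<theta>] by (simp add: z_def)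
    qed (use t D in auto)
    have lim: "(\<lambda>k. g k \<theta>) \<longlonglongrightarrow> (if \<alpha> + cis \<theta> * \<beta> = 0 then top else ennreal (t * ln (D / cmod (\<alpha> + cis \<theta> * \<beta>)))) * indicator {0..2 * pi} \<theta>"
      for \<theta>
    proof (cases "\<theta> \<in> {0..2 * pi}")
      case False then show ?thesis by (simp add: g_def)
    next
      case True
      have "(\<lambda>k. z k \<theta>) \<longlonglongrightarrow> \<alpha> + cis \<theta> * (of_real 1 * \<beta>)"
        unfolding z_def by (intro tendsto_intros \<rho>lim)
      then have zl: "(\<lambda>k. cmod (z k \<theta>)) \<longlonglongrightarrow> cmod (\<alpha> + cis \<theta> * \<beta>)"
        by (intro tendsto_norm) simp
      show ?thesis
      proof (cases "\<alpha> + cis \<theta> * \<beta> = 0")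
        case False
        have "(\<lambda>k. t * ln (D / cmod (z k \<theta>))) \<longlonglongrightarrow> t * ln (D / cmod (\<alpha> + cis \<theta> * \<beta>))"
          using False D by (intro tendsto_intros zl) auto
        then show ?thesis using True False by (simp add: g_def tendsto_ennrealI)
      next
        case zero: True
        have "z k \<theta> = of_real (1 - \<rho> k) * \<alpha> + of_real (\<rho> k) * (\<alpha> + cis \<theta> * \<beta>)" for k
          by (simp add: z_def algebra_simps)
        then have "cmod (z k \<theta>) = (1 - \<rho> k) * cmod \<alpha>" for k
          using \<rho>[of k] unfolding zero by (simp only: norm_mult norm_of_real mult_zero_right add_0_right)
        moreover have "1 - \<rho> k = 1 / (real k + 2)" for k by (simp add: \<rho>_def field_simps)
        ultimately have "t * ln (D / cmod (z k \<theta>)) = t * ln (D / cmod \<alpha> * (real k + 2))" for k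
          by simp
        moreover have "filterlim (\<lambda>k. t * ln (D / cmod \<alpha> * (real k + 2))) at_top sequentially"
        proof -
          have "0 < D / cmod \<alpha>" using D \<alpha> by simp
          then show ?thesis using t by real_asymp
        qed
        ultimately have "filterlim (\<lambda>k. t * ln (D / cmod (z k \<theta>))) at_top sequentially" by (simp only:)
        then have "(\<lambda>k. ennreal (t * ln (D / cmod (z k \<theta>)))) \<longlonglongrightarrow> top"
          by (simp add: ennreal_tendsto_top_eq_at_top)
        then show ?thesis using True zero by (simp add: g_def)
      qed
    qed
    have "(\<integral>\<^sup>+\<theta>\<in>{0..2 * pi}. (if \<alpha> + cis \<theta> * \<beta> = 0 then top else ennreal (t * ln (D / cmod (\<alpha> + cis \<theta> * \<beta>)))) \<partial>lborel)
        = (\<integral>\<^sup>+\<theta>. liminf (\<lambda>k. g k \<theta>) \<partial>lborel)"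
      by (intro nn_integral_cong lim_imp_Liminf[symmetric] lim) simp
    also have "\<dots> \<le> liminf (\<lambda>k. \<integral>\<^sup>+\<theta>. g k \<theta> \<partial>lborel)"
      by (rule nn_integral_liminf[OF gm])
    also have "\<dots> = ennreal (2 * pi * t * ln (D / cmod \<alpha>))"
      unfolding gI by (simp add: Liminf_const)
    finally show ?thesis .
  qed
qed

lemma norm_vector_smult: "norm (\<tau> *s b) = cmod \<tau> * norm b" for b :: "complex ^ 'n"
  by (simp add: norm_vec_def L2_set_def norm_mult power_mult_distrib real_sqrt_mult flip: sum_distrib_left)

text \<open>
  The orthogonal projection onto the complex line spanned by \<^term>\<open>x\<close> does not increase the norm
  and fixes \<^term>\<open>x\<close>, which reduces the inequality to the scalar one.
\<close>
lemma nn_integral_ln_norm_circle_le: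
  fixes x y :: "complex ^ 'n"
  assumes x: "x \<noteq> 0" and t: "0 < t" and D: "0 < D"
    and le: "\<And>\<theta>. norm (x + cis \<theta> *s y) \<le> D"
  shows "(\<integral>\<^sup>+\<theta>\<in>{0..2 * pi}. (if x + cis \<theta> *s y = 0 then top else ennreal (t * ln (D / norm (x + cis \<theta> *s y)))) \<partial>lborel)
    \<le> ennreal (2 * pi * t * ln (D / norm x))"
proof -
  \<comment> \<open>The coordinate of the projection of \<^term>\<open>v\<close> with respect to the unit vector in the direction
    of \<^term>\<open>x\<close>.\<close>
  define P where "P v = (\<Sum>i\<in>UNIV. v $ i * cnj (x $ i)) / of_real (norm x)" for v :: "complex ^ 'n"
  have P_le: "cmod (P v) \<le> norm v" for v
  proof -
    have "cmod (\<Sum>i\<in>UNIV. v $ i * cnj (x $ i)) \<le> (\<Sum>i\<in>UNIV. \<bar>cmod (v $ i)\<bar> * \<bar>cmod (x $ i)\<bar>)"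
      by (rule order_trans[OF norm_sum]) (simp add: norm_mult)
    also have "\<dots> \<le> norm v * norm x"
      unfolding norm_vec_def by (rule L2_set_mult_ineq)
    finally show ?thesis using x by (simp add: P_def norm_divide divide_le_eq)
  qed
  have P_x: "P x = of_real (norm x)"
  proof -
    have "(\<Sum>i\<in>UNIV. x $ i * cnj (x $ i)) = of_real ((norm x)\<^sup>2)"
      by (simp add: norm_vec_def L2_set_def sum_nonneg complex_norm_square[unfolded of_real_power])
    then show ?thesis using x by (simp add: P_def power2_eq_square)
  qed
  have P_lin: "P (x + c *s y) = P x + c * P y" for c
    by (simp add: P_def algebra_simps sum.distrib sum_distrib_left add_divide_distrib)
  have PD: "cmod (P x + cis \<theta> * P y) \<le> D" for \<theta>
    using P_le[of "x + cis \<theta> *s y"] le[of \<theta>] by (simp add: P_lin)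
  have "(\<integral>\<^sup>+\<theta>\<in>{0..2 * pi}. (if x + cis \<theta> *s y = 0 then top else ennreal (t * ln (D / norm (x + cis \<theta> *s y)))) \<partial>lborel)
     \<le> (\<integral>\<^sup>+\<theta>\<in>{0..2 * pi}. (if P x + cis \<theta> * P y = 0 then top else ennreal (t * ln (D / cmod (P x + cis \<theta> * P y)))) \<partial>lborel)"
  proof (intro nn_integral_mono mult_right_mono)
    fix \<theta>
    show "(if x + cis \<theta> *s y = 0 then top else ennreal (t * ln (D / norm (x + cis \<theta> *s y))))
      \<le> (if P x + cis \<theta> * P y = 0 then top else ennreal (t * ln (D / cmod (P x + cis \<theta> * P y))))"
    proof (cases "P x + cis \<theta> * P y = 0")
      case False
      then have p: "0 < cmod (P x + cis \<theta> * P y)" "cmod (P x + cis \<theta> * P y) \<le> norm (x + cis \<theta> *s y)"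
        using P_le[of "x + cis \<theta> *s y"] by (auto simp: P_lin)
      then have "x + cis \<theta> *s y \<noteq> 0" by auto
      moreover have "ln (D / norm (x + cis \<theta> *s y)) \<le> ln (D / cmod (P x + cis \<theta> * P y))"
        using p D by (subst ln_le_cancel_iff) (auto intro!: divide_left_mono divide_pos_pos mult_pos_pos)
      ultimately show ?thesis using False t by (simp add: ennreal_leI)
    qed simp
  qed simp
  also have "\<dots> \<le> ennreal (2 * pi * t * ln (D / cmod (P x)))"
    by (rule nn_integral_ln_circle_le) (use x t D PD in \<open>auto simp: P_x\<close>)
  also have "cmod (P x) = norm x" by (simp add: P_x)
  finally show ?thesis .
qed

section \<open>Sums of plurisubharmonic functions and logarithmic poles\<close>

lemma e2ennreal_uminus_add:
  fixes a b :: ereal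
  assumes "a \<le> 0" "b \<le> 0"
  shows "e2ennreal (- (a + b)) = e2ennreal (- a) + e2ennreal (- b)"
  using assms by (cases a; cases b) (auto simp: ennreal_plus[symmetric] simp del: ennreal_plus)

lemma subharmonic_on_add:
  fixes u v :: "complex \<Rightarrow> ereal"
  assumes u: "subharmonic_on S u" and v: "subharmonic_on S v"
    and nu: "\<And>z. z \<in> S \<Longrightarrow> u z \<le> 0" and nv: "\<And>z. z \<in> S \<Longrightarrow> v z \<le> 0"
  shows "subharmonic_on S (\<lambda>z. u z + v z)"
  unfolding subharmonic_on_def
proof (intro conjI ballI allI impI)
  note e = e2ennreal_uminus_add
  show "usc_on S (\<lambda>z. u z + v z)"
    using u v by (intro usc_on_add) (auto simp: subharmonic_on_def)
  show "u \<tau> + v \<tau> < \<infinity>" if "\<tau> \<in> S" for \<tau>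
    using nu[OF that] nv[OF that] by (cases "u \<tau>"; cases "v \<tau>") auto
  fix c r assume r: "0 < r \<and> cball c r \<subseteq> S"
  have on: "c + of_real r * cis \<theta> \<in> S" for \<theta>
    using r by (auto intro!: subsetD[of "cball c r" S] simp: dist_norm norm_mult)
  have cS: "c \<in> S" using r by auto
  have sph: "sphere c r \<subseteq> S" using r by auto
  have m: "(\<lambda>\<theta>. e2ennreal (- f (c + of_real r * cis \<theta>)) * indicator {0..2 * pi} \<theta>) \<in> borel_measurable borel"
    if "subharmonic_on S f" for f
  proof -
    have [measurable]: "(\<lambda>\<theta>. f (c + of_real r * cis \<theta>)) \<in> borel_measurable borel"
      using that r sph by (intro subharmonic_circle_measurable) (auto simp: subharmonic_on_def)
    show ?thesis by measurable
  qed
  have b: "(\<integral>\<^sup>+\<theta>\<in>{0..2 * pi}. e2ennreal (- f (c + of_real r * cis \<theta>)) \<partial>lborel) \<le> ennreal (2 * pi) * e2ennreal (- f c)"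
    if f: "subharmonic_on S f" and nf: "\<And>z. z \<in> S \<Longrightarrow> f z \<le> 0" for f
  proof -
    have "f c \<le> circle_mean f c r" using f r unfolding subharmonic_on_def by blast
    moreover have "f z \<le> 0" if "z \<in> sphere c r" for z using nf sph that by blast
    ultimately show ?thesis using r nf[OF cS] sub_mean_iff_nonpos[of r c f] by simp
  qed
  have "(\<integral>\<^sup>+\<theta>\<in>{0..2 * pi}. e2ennreal (- (u (c + of_real r * cis \<theta>) + v (c + of_real r * cis \<theta>))) \<partial>lborel)
    = (\<integral>\<^sup>+\<theta>\<in>{0..2 * pi}. e2ennreal (- u (c + of_real r * cis \<theta>)) \<partial>lborel)
      + (\<integral>\<^sup>+\<theta>\<in>{0..2 * pi}. e2ennreal (- v (c + of_real r * cis \<theta>)) \<partial>lborel)"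
    by (subst nn_integral_add[symmetric]) (auto intro!: m u v simp: e nu nv on distrib_right)
  also have "\<dots> \<le> ennreal (2 * pi) * e2ennreal (- u c) + ennreal (2 * pi) * e2ennreal (- v c)"
    by (intro add_mono b u v nu nv)
  also have "\<dots> = ennreal (2 * pi) * e2ennreal (- (u c + v c))"
    by (simp add: e nu nv cS distrib_left)
  finally show "u c + v c \<le> circle_mean (\<lambda>z. u z + v z) c r"
    using r sph cS nu nv by (subst sub_mean_iff_nonpos) (auto intro!: add_nonpos_nonpos)
qed

lemma plurisubharmonic_on_add:
  assumes u: "plurisubharmonic_on \<Omega> u" and v: "plurisubharmonic_on \<Omega> v"
    and nu: "\<And>z. z \<in> \<Omega> \<Longrightarrow> u z \<le> 0" and nv: "\<And>z. z \<in> \<Omega> \<Longrightarrow> v z \<le> 0"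
  shows "plurisubharmonic_on \<Omega> (\<lambda>z. u z + v z)"
  unfolding plurisubharmonic_on_def
proof (intro conjI ballI allI)
  show "usc_on \<Omega> (\<lambda>z. u z + v z)"
    using u v by (intro usc_on_add) (auto simp: plurisubharmonic_on_def)
  show "u z + v z < \<infinity>" if "z \<in> \<Omega>" for z
    using u v that by (auto simp: plurisubharmonic_on_def ereal_plus_eq_PInfty less_top)
  show "subharmonic_on {\<tau>. a + \<tau> *s b \<in> \<Omega>} (\<lambda>\<tau>. u (a + \<tau> *s b) + v (a + \<tau> *s b))" for a b
    using u v nu nv by (intro subharmonic_on_add) (auto simp: plurisubharmonic_on_def)
qed

lemma usc_on_const: "usc_on S (\<lambda>x. c)"
  by (auto simp: usc_on_iff_eventually)

lemma plurisubharmonic_on_zero: "plurisubharmonic_on \<Omega> (\<lambda>z. 0)"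
proof -
  have "(0::ereal) \<le> circle_mean (\<lambda>z. 0) c r" if "0 < r" for c r
    using that by (subst sub_mean_iff_nonpos) (auto simp: e2ennreal_neg)
  then show ?thesis by (auto simp: plurisubharmonic_on_def subharmonic_on_def usc_on_const)
qed

lemma plurisubharmonic_on_sum:
  assumes "finite I" and "\<And>i. i \<in> I \<Longrightarrow> plurisubharmonic_on \<Omega> (u i)"
    and "\<And>i z. i \<in> I \<Longrightarrow> z \<in> \<Omega> \<Longrightarrow> u i z \<le> 0"
  shows "plurisubharmonic_on \<Omega> (\<lambda>z. \<Sum>i\<in>I. u i z)"
  using assms
proof (induction I)
  case empty
  then show ?case by (simp add: plurisubharmonic_on_zero)
next
  case (insert i I)
  then show ?case by (simp add: plurisubharmonic_on_add sum_nonpos)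
qed

text \<open>
  The function $t \log(|z-p|/D)$ with its value $-\infty$ at the pole. The weight \<^prop>\<open>t = (0::real)\<close>
  is a separate case because the function then has no pole at all.
\<close>
definition log_pole :: "real \<Rightarrow> real \<Rightarrow> complex ^ 'n \<Rightarrow> complex ^ 'n \<Rightarrow> ereal" where
  "log_pole t D p z = (if t = 0 then 0 else if z = p then -\<infinity> else ereal (t * ln (norm (z - p) / D)))"

lemma log_pole_nonpos:
  assumes "0 \<le> t" "norm (z - p) \<le> D"
  shows "log_pole t D p z \<le> 0"
proof (cases "z = p")
  case False
  then have "0 < norm (z - p)" "0 < D" using assms(2) by (auto intro: less_le_trans[of 0 "norm (z - p)"])
  then have "ln (norm (z - p) / D) \<le> 0" using assms(2)
    by (subst ln_le_zero_iff) (auto simp: divide_le_eq)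
  then show ?thesis using assms(1) by (simp add: log_pole_def mult_nonneg_nonpos)
qed (simp add: log_pole_def)

lemma usc_on_log_pole:
  assumes t: "0 < t" and D: "0 < D"
  shows "usc_on S (log_pole t D p)"
proof -
  have "open {z. log_pole t D p z < c}" for c
  proof (cases c)
    case (real x)
    have "log_pole t D p z < c \<longleftrightarrow> norm (z - p) < D * exp (x / t)" for z
    proof (cases "z = p")
      case True then show ?thesis using real t D by (simp add: log_pole_def)
    next
      case False
      have "t * ln (norm (z - p) / D) < x \<longleftrightarrow> ln (norm (z - p) / D) < x / t"
        using t by (simp only: pos_less_divide_eq mult.commute)
      also have "\<dots> \<longleftrightarrow> norm (z - p) / D < exp (x / t)"
      proof -
        have "0 < norm (z - p) / D" using False D by simp
        then have "exp (ln (norm (z - p) / D)) = norm (z - p) / D" by (rule exp_ln)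
        then show ?thesis by (metis exp_less_cancel_iff)
      qed
      also have "\<dots> \<longleftrightarrow> norm (z - p) < D * exp (x / t)"
        using D by (simp only: pos_divide_less_eq mult.commute)
      finally show ?thesis using False real t by (simp add: log_pole_def)
    qed
    then have "{z. log_pole t D p z < c} = ball p (D * exp (x / t))"
      by (simp add: ball_def dist_norm norm_minus_commute)
    then show ?thesis by simp
  next
    case PInf
    then have "{z. log_pole t D p z < c} = UNIV" by (auto simp: log_pole_def)
    then show ?thesis by simp
  next
    case MInf
    then show ?thesis by simp
  qed
  then have "usc_on UNIV (log_pole t D p)" by (simp add: usc_on_def)
  then show ?thesis by (rule usc_on_subset) simp
qed

lemma continuous_on_complex_line:
  fixes a b :: "complex ^ 'n"
  shows "continuous_on S (\<lambda>\<tau>. a + \<tau> *s b)"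
  unfolding vector_scalar_mult_def by (intro continuous_intros)

lemma plurisubharmonic_log_pole:
  assumes t: "0 \<le> t" and D: "0 < D" and le: "\<And>z. z \<in> \<Omega> \<Longrightarrow> norm (z - p) \<le> D"
  shows "plurisubharmonic_on \<Omega> (log_pole t D p)"
proof (cases "t = 0")
  case True
  then have "log_pole t D p = (\<lambda>z. 0)" by (auto simp: log_pole_def)
  then show ?thesis by (simp add: plurisubharmonic_on_zero)
next
  case False
  then have t: "0 < t" using t by simp
  have fin: "log_pole t D p z < \<infinity>" for z by (simp add: log_pole_def)
  have e: "e2ennreal (- log_pole t D p z) = (if z - p = 0 then top else ennreal (t * ln (D / norm (z - p))))"
    for z using t D by (auto simp: log_pole_def ln_div right_diff_distrib)
  show ?thesis
    unfolding plurisubharmonic_on_def subharmonic_on_def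
  proof (intro conjI ballI allI impI fin usc_on_log_pole t D)
    fix a b
    show "usc_on {\<tau>. a + \<tau> *s b \<in> \<Omega>} (\<lambda>\<tau>. log_pole t D p (a + \<tau> *s b))"
      by (rule usc_on_compose[OF usc_on_log_pole[OF t D, of UNIV] continuous_on_complex_line]) simp
    fix c r assume r: "0 < r \<and> cball c r \<subseteq> {\<tau>. a + \<tau> *s b \<in> \<Omega>}"
    have on: "a + \<tau> *s b \<in> \<Omega>" if "\<tau> \<in> cball c r" for \<tau> using r that by auto
    define x where "x = a + c *s b - p"
    define y where "y = of_real r *s b"
    have xy: "a + (c + of_real r * cis \<theta>) *s b - p = x + cis \<theta> *s y" for \<theta>
      by (simp add: x_def y_def vector_sadd_rdistrib vector_smult_assoc mult.commute algebra_simps)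
    have xyD: "norm (x + cis \<theta> *s y) \<le> D" for \<theta>
      unfolding xy[symmetric] using r by (intro le on) (simp add: dist_norm norm_mult)
    have "(\<integral>\<^sup>+\<theta>\<in>{0..2 * pi}. e2ennreal (- log_pole t D p (a + (c + of_real r * cis \<theta>) *s b)) \<partial>lborel)
      \<le> ennreal (2 * pi) * e2ennreal (- log_pole t D p (a + c *s b))"
    proof (cases "x = 0")
      case True
      then have "e2ennreal (- log_pole t D p (a + c *s b)) = top" using e[of "a + c *s b"] by (simp add: x_def)
      then show ?thesis by (simp add: ennreal_mult_top)
    next
      case False
      have "ennreal (2 * pi * t * ln (D / norm x)) = ennreal (2 * pi) * ennreal (t * ln (D / norm x))"
        using ennreal_mult'[of "2 * pi" "t * ln (D / norm x)"] by (simp only: mult.assoc) simp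
      then show ?thesis
        unfolding e xy x_def[symmetric]
        using nn_integral_ln_norm_circle_le[OF False t D xyD] False by (simp only: if_False)
    qed
    then show "log_pole t D p (a + c *s b) \<le> circle_mean (\<lambda>\<tau>. log_pole t D p (a + \<tau> *s b)) c r"
      by (subst sub_mean_iff_nonpos) (use r t in \<open>auto intro!: log_pole_nonpos le on\<close>)
  qed
qed

section \<open>The maximum principle near a pole\<close>

text \<open>
  The maximum principle on the annulus, for the difference of \<^term>\<open>u\<close>, restricted to the complex
  line through \<^term>\<open>p\<close> and \<^term>\<open>z\<close>, and the harmonic function $t\log(|\tau|/R)$. Adding
  $\epsilon|\tau|^2$ makes the sub-mean inequality strict, so that a maximum cannot be interior.

  Consequently, a bound by $t\log(r/R)$ on one sphere spreads to all larger spheres; conversely,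
  where it fails, it fails on all smaller spheres as well.
\<close>
lemma plurisubharmonic_annulus_bound:
  fixes u :: "complex ^ 'n \<Rightarrow> ereal"
  assumes u: "plurisubharmonic_on \<Omega> u" and neg: "\<And>z. z \<in> \<Omega> \<Longrightarrow> u z \<le> 0"
    and sub: "cball p R \<subseteq> \<Omega>" and r: "0 < r" and t: "0 \<le> t"
    and bd: "\<And>z. norm (z - p) = r \<Longrightarrow> u z \<le> ereal (t * ln (r / R))"
    and z: "r \<le> norm (z - p)" "norm (z - p) \<le> R"
  shows "u z \<le> ereal (t * ln (norm (z - p) / R))"
proof -
  define N where "N = norm (z - p)"
  have N: "0 < N" "r \<le> N" "N \<le> R" and R: "0 < R" using r z by (auto simp: N_def)
  define b where "b = of_real (1 / N) *s (z - p)"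
  have "norm b = cmod (of_real (1 / N)) * N" by (simp only: b_def norm_vector_smult N_def[symmetric])
  then have nb: "norm b = 1" using N by (simp add: norm_divide)
  have zb: "p + of_real N *s b = z" using N by (simp add: b_def vector_smult_assoc)
  define K where "K = {\<tau>. r \<le> cmod \<tau> \<and> cmod \<tau> \<le> R}"
  have on: "p + \<tau> *s b \<in> \<Omega>" if "cmod \<tau> \<le> R" for \<tau>
    using sub that by (auto intro!: subsetD[OF sub] simp: dist_norm norm_vector_smult nb)
  have K: "compact K" "K \<noteq> {}"
  proof -
    have "K = cball 0 R - ball 0 r" by (auto simp: K_def)
    then show "compact K" by (simp add: compact_diff)
    show "K \<noteq> {}" using N by (auto simp: K_def intro!: exI[of _ "of_real N"])
  qed
  have bound: "u z \<le> ereal (t * ln (N / R) + \<epsilon> * R\<^sup>2)" if \<epsilon>: "0 < \<epsilon>" for \<epsilon>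
  proof -
    define g where "g \<tau> = t * ln (cmod \<tau> / R) - \<epsilon> * (cmod \<tau>)\<^sup>2" for \<tau>
    define f where "f \<tau> = u (p + \<tau> *s b) + ereal (- g \<tau>)" for \<tau>
    have "usc_on K f"
      unfolding f_def
    proof (rule usc_on_add)
      show "usc_on K (\<lambda>\<tau>. u (p + \<tau> *s b))"
        by (rule usc_on_compose[of \<Omega> u, OF _ continuous_on_complex_line])
          (use u on in \<open>auto simp: plurisubharmonic_on_def K_def\<close>)
      have "continuous_on K (\<lambda>\<tau>. ereal (- g \<tau>))"
        unfolding g_def using r R by (intro continuous_intros) (auto simp: K_def)
      then have "((\<lambda>\<tau>. ereal (- g \<tau>)) \<longlongrightarrow> ereal (- g x)) (at x within K)" if "x \<in> K" for x
        using that by (simp add: continuous_on_def)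
      then show "usc_on K (\<lambda>\<tau>. ereal (- g \<tau>))"
        unfolding usc_on_iff_eventually using order_tendstoD(2) by blast
    qed (use u on in \<open>auto simp: plurisubharmonic_on_def K_def\<close>)
    then obtain \<tau> where \<tau>: "\<tau> \<in> K" and max: "\<And>y. y \<in> K \<Longrightarrow> f y \<le> f \<tau>"
      using usc_on_attains_max[OF K] by blast
    have \<tau>0: "\<tau> \<noteq> 0" and \<tau>R: "r \<le> cmod \<tau>" "cmod \<tau> \<le> R" using \<tau> r by (auto simp: K_def)
    have "f \<tau> \<le> ereal (\<epsilon> * R\<^sup>2)"
    proof (rule ccontr)
      assume "\<not> ?thesis"
      then have gt: "ereal (\<epsilon> * R\<^sup>2) < f \<tau>" by simp
      have u\<tau>: "u (p + \<tau> *s b) \<le> 0" using neg on \<tau>R by blast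
      obtain y where y: "u (p + \<tau> *s b) = ereal y"
        using gt u\<tau> by (cases "u (p + \<tau> *s b)") (auto simp: f_def)
      have gt': "\<epsilon> * R\<^sup>2 < y - g \<tau>" using gt y by (simp add: f_def)
      have sq: "\<epsilon> * (cmod \<tau>)\<^sup>2 \<le> \<epsilon> * R\<^sup>2" using \<epsilon> \<tau>R by (intro mult_left_mono power_mono) auto
      \<comment> \<open>On the two boundary circles the hypotheses bound the perturbed difference, so the maximum is
        attained in the open annulus.\<close>
      have "cmod \<tau> \<noteq> R"
        using gt' sq y u\<tau> R by (auto simp: g_def)
      moreover have "cmod \<tau> \<noteq> r"
      proof
        assume "cmod \<tau> = r"
        then have "u (p + \<tau> *s b) \<le> ereal (t * ln (cmod \<tau> / R))"
          using bd[of "p + \<tau> *s b"] by (simp add: norm_vector_smult nb)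
        then show False using gt' sq y by (simp add: g_def)
      qed
      ultimately have int: "r < cmod \<tau>" "cmod \<tau> < R" using \<tau>R by auto
      define s where "s = min (cmod \<tau> - r) (R - cmod \<tau>)"
      have s: "0 < s" "s \<le> cmod \<tau> - r" "s \<le> R - cmod \<tau>" using int by (auto simp: s_def)
      \<comment> \<open>Maximality bounds \<^term>\<open>u\<close> on a small circle by \<^term>\<open>q\<close>, whose mean falls short of
        the value \<^term>\<open>y\<close> at the centre by $\epsilon s^2$.\<close>
      define q where "q \<theta> = (y - g \<tau>) + g (\<tau> + cis \<theta> * of_real s)" for \<theta>
      have circ: "\<tau> + cis \<theta> * of_real s \<in> K" for \<theta>
        using s norm_triangle_ineq[of \<tau> "cis \<theta> * of_real s"] norm_triangle_ineq2[of \<tau> "- (cis \<theta> * of_real s)"]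
        by (auto simp: K_def norm_mult)
      have nz: "\<tau> + cis \<theta> * of_real s \<noteq> 0" for \<theta>
        using circ[of \<theta>] r by (auto simp: K_def)
      have shift: "(p + \<tau> *s b) + x *s (of_real s *s b) = p + (\<tau> + x * of_real s) *s b" for x
        by (simp add: vector_sadd_rdistrib vector_smult_assoc)
      have sq_int: "((\<lambda>\<theta>. (cmod (\<tau> + cis \<theta> * of_real s))\<^sup>2) has_integral 2 * pi * ((cmod \<tau>)\<^sup>2 + s\<^sup>2)) {0..2 * pi}"
      proof -
        have sq: "(a + s * C)\<^sup>2 + (b + s * S)\<^sup>2 = a\<^sup>2 + b\<^sup>2 + s\<^sup>2 * (S\<^sup>2 + C\<^sup>2) + (2 * s * a) * C + (2 * s * b) * S"
          for a b C S :: real by (simp add: power2_eq_square algebra_simps)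
        have e: "(cmod (\<tau> + cis \<theta> * of_real s))\<^sup>2 = ((cmod \<tau>)\<^sup>2 + s\<^sup>2) + (2 * s * Re \<tau>) * cos \<theta> + (2 * s * Im \<tau>) * sin \<theta>" for \<theta>
        proof -
          have "(cmod (\<tau> + cis \<theta> * of_real s))\<^sup>2 = (Re \<tau> + s * cos \<theta>)\<^sup>2 + (Im \<tau> + s * sin \<theta>)\<^sup>2"
            by (simp add: cmod_power2 mult.commute)
          also have "\<dots> = (Re \<tau>)\<^sup>2 + (Im \<tau>)\<^sup>2 + s\<^sup>2 * ((sin \<theta>)\<^sup>2 + (cos \<theta>)\<^sup>2) + (2 * s * Re \<tau>) * cos \<theta> + (2 * s * Im \<tau>) * sin \<theta>"
            by (rule sq)
          finally show ?thesis by (simp add: cmod_power2)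
        qed
        have i1: "((\<lambda>\<theta>. (cmod \<tau>)\<^sup>2 + s\<^sup>2) has_integral 2 * pi * ((cmod \<tau>)\<^sup>2 + s\<^sup>2)) {0..2 * pi}"
          using has_integral_const_real[of "(cmod \<tau>)\<^sup>2 + s\<^sup>2" 0 "2 * pi"] by simp
        have i2: "(cos has_integral (sin (2 * pi) - sin 0)) {0..2 * pi}"
          by (rule fundamental_theorem_of_calculus)
            (auto intro!: derivative_eq_intros simp: has_real_derivative_iff_has_vector_derivative[symmetric])
        have i3: "(sin has_integral (- cos (2 * pi) - - cos 0)) {0..2 * pi}"
          by (rule fundamental_theorem_of_calculus)
            (auto intro!: derivative_eq_intros simp: has_real_derivative_iff_has_vector_derivative[symmetric])
        have "((\<lambda>\<theta>. ((cmod \<tau>)\<^sup>2 + s\<^sup>2) + (2 * s * Re \<tau>) * cos \<theta> + (2 * s * Im \<tau>) * sin \<theta>) has_integral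
            2 * pi * ((cmod \<tau>)\<^sup>2 + s\<^sup>2) + (2 * s * Re \<tau>) * (sin (2 * pi) - sin 0) + (2 * s * Im \<tau>) * (- cos (2 * pi) - - cos 0)) {0..2 * pi}"
          by (intro has_integral_add has_integral_mult_right i1 i2 i3)
        then show ?thesis unfolding e by simp
      qed
      have ln_int: "((\<lambda>\<theta>. ln (cmod (\<tau> + cis \<theta> * of_real s))) has_integral 2 * pi * ln (cmod \<tau>)) {0..2 * pi}"
        by (rule has_integral_ln_norm_circle) (use s r in simp)
      have c_int: "((\<lambda>\<theta>. c) has_integral 2 * pi * c) {0..2 * pi}" for c :: real
        using has_integral_const_real[of c 0 "2 * pi"] by simp
      have "((\<lambda>\<theta>. (y - g \<tau> - t * ln R) + (t * ln (cmod (\<tau> + cis \<theta> * of_real s)) - \<epsilon> * (cmod (\<tau> + cis \<theta> * of_real s))\<^sup>2)) has_integral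
          2 * pi * (y - g \<tau> - t * ln R) + (t * (2 * pi * ln (cmod \<tau>)) - \<epsilon> * (2 * pi * ((cmod \<tau>)\<^sup>2 + s\<^sup>2)))) {0..2 * pi}"
        by (intro has_integral_add has_integral_diff has_integral_mult_right c_int ln_int sq_int)
      moreover have "(y - g \<tau> - t * ln R) + (t * ln (cmod (\<tau> + cis \<theta> * of_real s)) - \<epsilon> * (cmod (\<tau> + cis \<theta> * of_real s))\<^sup>2) = q \<theta>" for \<theta>
      proof -
        have "0 < cmod (\<tau> + cis \<theta> * of_real s)" using circ[of \<theta>] r by (auto simp: K_def)
        then show ?thesis using R by (simp add: q_def g_def ln_div algebra_simps)
      qed
      moreover have "2 * pi * (y - g \<tau> - t * ln R) + (t * (2 * pi * ln (cmod \<tau>)) - \<epsilon> * (2 * pi * ((cmod \<tau>)\<^sup>2 + s\<^sup>2)))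
          = 2 * pi * (y - \<epsilon> * s\<^sup>2)"
        using R \<tau>0 by (simp add: g_def ln_div algebra_simps)
      ultimately have q: "(q has_integral 2 * pi * (y - \<epsilon> * s\<^sup>2)) {0..2 * pi}" by simp
      have "u (p + \<tau> *s b) \<le> ereal ((2 * pi * (y - \<epsilon> * s\<^sup>2)) / (2 * pi))"
      proof (rule plurisubharmonic_mean_le[OF u neg _ _ q])
        show "(p + \<tau> *s b) + x *s (of_real s *s b) \<in> \<Omega>" if "cmod x \<le> 1" for x
          unfolding shift
        proof (rule on)
          have "cmod (\<tau> + x * of_real s) \<le> cmod \<tau> + cmod x * s"
            using norm_triangle_ineq[of \<tau> "x * of_real s"] s by (simp add: norm_mult)
          also have "\<dots> \<le> cmod \<tau> + 1 * s" using that s by (intro add_left_mono mult_right_mono) auto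
          finally show "cmod (\<tau> + x * of_real s) \<le> R" using s by simp
        qed
        show "u ((p + \<tau> *s b) + cis \<theta> *s (of_real s *s b)) \<le> ereal (q \<theta>)" for \<theta>
          using max[OF circ[of \<theta>]] y unfolding shift f_def q_def
          by (cases "u (p + (\<tau> + cis \<theta> * of_real s) *s b)") auto
        show "continuous_on {0..2 * pi} q"
          unfolding q_def g_def using nz R by (intro continuous_intros) auto
      qed auto
      then show False using y mult_pos_pos[OF \<epsilon>, of "s\<^sup>2"] s by simp
    qed
    moreover have "f (of_real N) \<le> f \<tau>" using N by (intro max) (auto simp: K_def)
    ultimately have "u z - ereal (g (of_real N)) \<le> ereal (\<epsilon> * R\<^sup>2)"
      by (simp add: f_def zb minus_ereal_def)
    then have "u z \<le> ereal (g (of_real N) + \<epsilon> * R\<^sup>2)"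
      by (cases "u z") auto
    also have "\<dots> \<le> ereal (t * ln (N / R) + \<epsilon> * R\<^sup>2)" using N \<epsilon> by (simp add: g_def)
    finally show ?thesis .
  qed
  show ?thesis
    unfolding N_def[symmetric]
  proof (rule ereal_le_epsilon2)
    fix e :: real assume e: "0 < e"
    have "u z \<le> ereal (t * ln (N / R) + e / R\<^sup>2 * R\<^sup>2)" using e R by (intro bound) auto
    then show "u z \<le> ereal (t * ln (N / R)) + ereal e" using R by simp
  qed
qed

lemma ereal_le_mult_limit:
  fixes y :: ereal and x t :: real
  assumes x: "x \<le> 0" and t: "0 < t" and le: "\<And>s. 0 \<le> s \<Longrightarrow> s < t \<Longrightarrow> y \<le> ereal (s * x)"
  shows "y \<le> ereal (t * x)"
proof (rule ereal_le_epsilon2)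
  fix e :: real assume e: "0 < e"
  \<comment> \<open>Dividing by \<^term>\<open>1 - x\<close> rather than by \<^term>\<open>- x\<close> includes the case \<^prop>\<open>x = (0::real)\<close>.\<close>
  define s where "s = max 0 (t - e / (1 - x))"
  have "0 < e / (1 - x)" using e x by (intro divide_pos_pos) auto
  then have s: "0 \<le> s" "s < t" using t by (auto simp: s_def)
  have "s * x \<le> (t - e / (1 - x)) * x" using x by (intro mult_right_mono_neg) (simp_all add: s_def)
  also have "\<dots> = t * x + e * (- x / (1 - x))" by (simp add: algebra_simps)
  also have "\<dots> \<le> t * x + e * 1"
  proof (intro add_left_mono mult_left_mono)
    show "- x / (1 - x) \<le> 1" using x by (subst pos_divide_le_eq) auto
  qed (use e in simp)
  finally have "ereal (s * x) \<le> ereal (t * x) + ereal e" by simp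
  then show "y \<le> ereal (t * x) + ereal e" using le[OF s] by (rule order_trans[rotated])
qed

lemma ln_ratio_nonpos: "0 < N \<Longrightarrow> N \<le> R \<Longrightarrow> ln (N / R) \<le> (0::real)"
  by (subst ln_le_zero_iff) (auto simp: divide_le_eq)

text \<open>
  The unknown additive constant in the pole condition disappears: it is absorbed by replacing
  \<^term>\<open>t\<close> by a smaller \<^term>\<open>s\<close> on a sufficiently small sphere, the annulus bound carries the
  estimate outwards, and \<^term>\<open>s\<close> tends to \<^term>\<open>t\<close>. The resulting bound is uniform over the
  whole class of competitors and therefore passes to the Green function.
\<close>
lemma plurisubharmonic_pole_bound:
  fixes u :: "complex ^ 'n \<Rightarrow> ereal"
  assumes u: "plurisubharmonic_on \<Omega> u" and neg: "\<And>z. z \<in> \<Omega> \<Longrightarrow> u z \<le> 0"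
    and sub: "cball p R \<subseteq> \<Omega>" and t: "0 \<le> t"
    and ev: "\<forall>\<^sub>F \<zeta> in at p. u \<zeta> - ereal (t * ln (norm (\<zeta> - p))) \<le> ereal C"
    and z: "z \<noteq> p" "norm (z - p) \<le> R"
  shows "u z \<le> ereal (t * ln (norm (z - p) / R))"
proof (cases "t = 0")
  case True
  have "z \<in> \<Omega>" using sub z by (auto simp: dist_norm norm_minus_commute)
  then show ?thesis using True neg by (simp add: zero_ereal_def)
next
  case False
  define N where "N = norm (z - p)"
  have N: "0 < N" "N \<le> R" and R: "0 < R" using z by (auto simp: N_def intro: less_le_trans[of 0 "norm (z - p)"])
  obtain \<delta> where \<delta>: "0 < \<delta>" and near: "\<And>\<zeta>. \<zeta> \<noteq> p \<Longrightarrow> norm (\<zeta> - p) < \<delta> \<Longrightarrow> u \<zeta> - ereal (t * ln (norm (\<zeta> - p))) \<le> ereal C"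
    using ev unfolding eventually_at by (auto simp: dist_norm)
  show ?thesis
    unfolding N_def[symmetric]
  proof (rule ereal_le_mult_limit)
    show "ln (N / R) \<le> 0" using N by (rule ln_ratio_nonpos)
    show "0 < t" using t False by simp
    fix s assume s: "0 \<le> s" "s < t"
    \<comment> \<open>For radii up to \<^term>\<open>exp m\<close> the function $t\log r + C$ lies below $s\log(r/R)$.\<close>
    define m where "m = (- C - s * ln R) / (t - s)"
    define r where "r = min N (min (\<delta> / 2) (exp m))"
    have r: "0 < r" "r \<le> N" "r < \<delta>" "r \<le> exp m" using N \<delta> by (auto simp: r_def)
    have "ln r \<le> m" using r by (metis ln_exp ln_mono)
    then have "(t - s) * ln r \<le> - C - s * ln R" using s by (simp add: m_def pos_le_divide_eq mult.commute)
    then have le: "t * ln r + C \<le> s * ln (r / R)" using r R by (simp add: ln_div algebra_simps)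
    show "u z \<le> ereal (s * ln (N / R))"
      unfolding N_def
    proof (rule plurisubharmonic_annulus_bound[OF u neg sub r(1) s(1)])
      fix y assume y: "norm (y - p) = r"
      then have "u y - ereal (t * ln r) \<le> ereal C" using near[of y] r by auto
      then have "u y \<le> ereal (t * ln r + C)" by (cases "u y") auto
      then show "u y \<le> ereal (s * ln (r / R))" using le by (meson ereal_less_eq(3) order_trans)
    qed (use r N in \<open>auto simp: N_def\<close>)
  qed
qed

lemma plurisubharmonic_center_le:
  fixes u :: "complex ^ 'n \<Rightarrow> ereal"
  assumes u: "plurisubharmonic_on \<Omega> u" and neg: "\<And>z. z \<in> \<Omega> \<Longrightarrow> u z \<le> 0"
    and sub: "cball p r \<subseteq> \<Omega>" and r: "0 < r" and le: "\<And>z. norm (z - p) = r \<Longrightarrow> u z \<le> ereal c"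
  shows "u p \<le> ereal c"
proof -
  obtain b :: "complex ^ 'n" where b: "norm b = r" using vector_choose_size[of r] r by auto
  have "u p \<le> ereal (2 * pi * c / (2 * pi))"
  proof (rule plurisubharmonic_mean_le[OF u neg])
    show "p + \<tau> *s b \<in> \<Omega>" if "cmod \<tau> \<le> 1" for \<tau>
      using that r by (intro subsetD[OF sub]) (simp add: dist_norm norm_vector_smult b mult_left_le_one_le)
    show "u (p + cis \<theta> *s b) \<le> ereal c" for \<theta>
      by (rule le) (simp add: norm_vector_smult b)
    show "((\<lambda>\<theta>. c) has_integral 2 * pi * c) {0..2 * pi}"
      using has_integral_const_real[of c 0 "2 * pi"] by simp
  qed auto
  then show ?thesis by simp
qed

lemma plurisubharmonic_ball_le:
  fixes u :: "complex ^ 'n \<Rightarrow> ereal"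
  assumes u: "plurisubharmonic_on \<Omega> u" and neg: "\<And>z. z \<in> \<Omega> \<Longrightarrow> u z \<le> 0"
    and sub: "cball p R \<subseteq> \<Omega>" and t: "0 \<le> t"
    and bd: "\<And>z. z \<noteq> p \<Longrightarrow> norm (z - p) \<le> R \<Longrightarrow> u z \<le> ereal (t * ln (norm (z - p) / R))"
    and r: "0 < r" "r \<le> R" and z: "norm (z - p) \<le> r"
  shows "u z \<le> ereal (t * ln (r / R))"
proof (cases "z = p")
  case True
  have "u p \<le> ereal (t * ln (r / R))"
  proof (rule plurisubharmonic_center_le[OF u neg _ r(1)])
    show "cball p r \<subseteq> \<Omega>" using sub r by auto
    show "u y \<le> ereal (t * ln (r / R))" if "norm (y - p) = r" for y
      using bd[of y] that r by auto
  qed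
  then show ?thesis using True by simp
next
  case False
  then have N: "0 < norm (z - p)" by simp
  have "ln (norm (z - p) / R) \<le> ln (r / R)"
    using N z r by (subst ln_le_cancel_iff) (auto intro!: divide_right_mono)
  then have "t * ln (norm (z - p) / R) \<le> t * ln (r / R)" using t by (rule mult_left_mono)
  then show ?thesis using bd[OF False] z r by (meson ereal_less_eq(3) order_trans)
qed

lemma ennreal_le_e2ennreal_uminus: "x \<le> ereal (- k) \<Longrightarrow> ennreal k \<le> e2ennreal (- x)"
  by (cases x) (auto intro!: ennreal_leI)

lemma e2ennreal_uminus_le_ennreal: "ereal (- k) \<le> x \<Longrightarrow> e2ennreal (- x) \<le> ennreal k"
  by (cases x) (auto intro!: ennreal_leI simp: e2ennreal_neg)

section \<open>Additivity of logarithmic weights\<close>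

text \<open>
  This is the Harnack-type estimate behind the additivity of the logarithmic weights. The points
  \<^term>\<open>a\<close> and \<^term>\<open>b\<close> lie on a common complex line, on which lengths are measured in units of
  \<^term>\<open>r\<close>. The disc of radius 1 about \<^term>\<open>a\<close> is contained in the disc of radius 3 about
  \<^term>\<open>b\<close>. The area mean of \<^term>\<open>- u\<close> over the small disc is at most \<^term>\<open>A\<close>, that of
  \<^term>\<open>- v\<close> over the large disc at most \<^term>\<open>B\<close>. On the small disc the sum of \<^term>\<open>- u\<close> and \<^term>\<open>- v\<close> is
  at least \<^term>\<open>k\<close>, and on the remaining 8/9 of the large disc \<^term>\<open>- v\<close> is at least
  \<^term>\<open>m\<close>.
\<close>
lemma plurisubharmonic_two_disc_inequality:
  fixes u v :: "complex ^ 'n \<Rightarrow> ereal"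
  assumes u: "plurisubharmonic_on \<Omega> u" and nu: "\<And>z. z \<in> \<Omega> \<Longrightarrow> u z \<le> 0"
    and v: "plurisubharmonic_on \<Omega> v" and nv: "\<And>z. z \<in> \<Omega> \<Longrightarrow> v z \<le> 0"
    and sub: "cball p (4 * r) \<subseteq> \<Omega>" and r: "0 < r"
    and a: "norm (a - p) = r" "ereal (- A) \<le> u a" and b: "norm (b - p) = r" "ereal (- B) \<le> v b"
    and m: "0 \<le> m" "\<And>z. norm (z - p) \<le> 4 * r \<Longrightarrow> v z \<le> ereal (- m)"
    and k: "0 \<le> k" "\<And>z. norm (z - p) \<le> 4 * r \<Longrightarrow> u z + v z \<le> ereal (- k)"
  shows "k + 8 * m \<le> A + 9 * B"
proof -
  obtain d \<sigma> where d: "norm d = r" and \<sigma>: "cmod \<sigma> \<le> 2" and ab: "a + \<sigma> *s d = b"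
  proof (cases "a = b")
    case True
    \<comment> \<open>Any direction of norm \<^term>\<open>r\<close> serves here.\<close>
    show ?thesis by (rule that[of "a - p" 0]) (use a True in auto)
  next
    case False
    define N where "N = norm (b - a)"
    have N: "0 < N" using False by (simp add: N_def)
    have "norm (b - a) \<le> norm (b - p) + norm (a - p)"
      by (metis diff_diff_eq2 add_diff_cancel norm_triangle_ineq4 diff_add_cancel)
    then have N2: "N \<le> 2 * r" using a b by (simp add: N_def)
    show ?thesis
    proof (rule that[of "of_real (r / N) *s (b - a)" "of_real (N / r)"])
      have "norm (of_real (r / N) *s (b - a)) = cmod (of_real (r / N)) * N" by (simp only: norm_vector_smult N_def[symmetric])
      then show "norm (of_real (r / N) *s (b - a)) = r" using N r by (simp add: norm_divide)
      show "cmod (of_real (N / r)) \<le> 2" using N N2 r by (simp add: norm_divide divide_le_eq)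
      have "of_real (N / r) * of_real (r / N) = (1 :: complex)" using N r by simp
      then have "of_real (N / r) *s (of_real (r / N) *s (b - a)) = b - a"
        by (simp only: vector_smult_assoc vector_smult_lid)
      then show "a + of_real (N / r) *s (of_real (r / N) *s (b - a)) = b" by (simp only:) simp
    qed
  qed
  define D D' :: "complex set" where "D = ball 0 1" and "D' = ball \<sigma> 3"
  have DD': "D \<subseteq> D'"
  proof
    fix \<tau> assume "\<tau> \<in> D"
    then have "cmod (\<sigma> - \<tau>) < 3" using norm_triangle_ineq4[of \<sigma> \<tau>] \<sigma> by (simp add: D_def)
    then show "\<tau> \<in> D'" by (simp add: D'_def dist_norm)
  qed
  have in_ball: "norm (a + \<tau> *s d - p) \<le> 4 * r" if "\<tau> \<in> D'" for \<tau>
  proof -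
    have eq: "a + \<tau> *s d - p = (b - p) + (\<tau> - \<sigma>) *s d"
      unfolding ab[symmetric] by (simp add: vector_ssub_ldistrib vector_sadd_rdistrib algebra_simps)
    have "norm (a + \<tau> *s d - p) \<le> norm (b - p) + cmod (\<tau> - \<sigma>) * r"
      unfolding eq by (rule order_trans[OF norm_triangle_ineq]) (simp only: norm_vector_smult d order_refl)
    also have "\<dots> \<le> r + 3 * r"
      using that r b by (intro add_mono mult_right_mono) (auto simp: D'_def dist_norm norm_minus_commute)
    finally show ?thesis by simp
  qed
  have in_\<Omega>: "a + \<tau> *s d \<in> \<Omega>" if "\<tau> \<in> D'" for \<tau>
    using in_ball[OF that] by (intro subsetD[OF sub]) (simp add: dist_norm norm_minus_commute)
  define U V where "U \<tau> = e2ennreal (- u (a + \<tau> *s d))" and "V \<tau> = e2ennreal (- v (a + \<tau> *s d))" for \<tau>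
  have [measurable]: "(\<lambda>\<tau>. U \<tau> * indicator D \<tau>) \<in> borel_measurable borel"
    unfolding U_def D_def
    by (rule plurisubharmonic_disc_measurable[OF u]) (use in_\<Omega> DD' in \<open>auto simp: D_def\<close>)
  have [measurable]: "(\<lambda>\<tau>. V \<tau> * indicator D' \<tau>) \<in> borel_measurable borel"
    unfolding V_def D'_def
    by (rule plurisubharmonic_disc_measurable[OF v]) (use in_\<Omega> in \<open>auto simp: D'_def dist_norm norm_minus_commute\<close>)
  have volD: "emeasure lborel D = ennreal pi" and volD': "emeasure lborel D' = ennreal (9 * pi)"
    by (simp_all add: D_def D'_def emeasure_ball eval_unit_ball_vol mult.commute)
  have [measurable]: "D \<in> sets borel" "D' \<in> sets borel" by (simp_all add: D_def D'_def)
  have "emeasure lborel (D' - D) = ennreal (9 * pi) - ennreal pi"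
    using DD' by (subst emeasure_Diff) (simp_all add: volD volD')
  then have vol: "emeasure lborel (D' - D) = ennreal (8 * pi)" by (simp add: ennreal_minus)
  have kUV: "ennreal k \<le> U \<tau> + V \<tau>" if "\<tau> \<in> D" for \<tau>
  proof -
    have \<tau>: "\<tau> \<in> D'" using DD' that by blast
    have "ennreal k \<le> e2ennreal (- (u (a + \<tau> *s d) + v (a + \<tau> *s d)))"
      by (rule ennreal_le_e2ennreal_uminus[OF k(2)[OF in_ball[OF \<tau>]]])
    then show ?thesis using nu nv in_\<Omega>[OF \<tau>] by (simp add: e2ennreal_uminus_add U_def V_def)
  qed
  have mV: "ennreal m \<le> V \<tau>" if "\<tau> \<in> D'" for \<tau>
    unfolding V_def by (rule ennreal_le_e2ennreal_uminus[OF m(2)[OF in_ball[OF that]]])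
  have "ennreal (pi * k + 8 * pi * m) = (\<integral>\<^sup>+\<tau>. ennreal k * indicator D \<tau> + ennreal m * indicator (D' - D) \<tau> \<partial>lborel)"
    using k(1) m(1) by (subst nn_integral_add) (simp_all add: nn_integral_cmult_indicator volD vol ennreal_plus ennreal_mult mult_ac)
  also have "\<dots> \<le> (\<integral>\<^sup>+\<tau>. U \<tau> * indicator D \<tau> + V \<tau> * indicator D' \<tau> \<partial>lborel)"
    using kUV mV DD' by (intro nn_integral_mono) (auto simp: indicator_def)
  also have "\<dots> = (\<integral>\<^sup>+\<tau>\<in>D. U \<tau> \<partial>lborel) + (\<integral>\<^sup>+\<tau>\<in>D'. V \<tau> \<partial>lborel)"
    by (rule nn_integral_add) measurable
  also have "\<dots> \<le> emeasure lborel D * e2ennreal (- u (a + 0 *s d)) + emeasure lborel D' * e2ennreal (- v (a + \<sigma> *s d))"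
    unfolding U_def V_def D_def D'_def
    by (intro add_mono plurisubharmonic_disc_bound[OF u nu] plurisubharmonic_disc_bound[OF v nv])
      (use in_\<Omega> DD' in \<open>auto simp: D_def D'_def dist_norm norm_minus_commute\<close>)
  also have "\<dots> \<le> ennreal pi * ennreal A + ennreal (9 * pi) * ennreal B"
    unfolding ab volD volD' using a(2) b(2)
    by (intro add_mono mult_left_mono) (auto intro: e2ennreal_uminus_le_ennreal)
  finally have *: "ennreal (pi * k + 8 * pi * m) \<le> ennreal pi * ennreal A + ennreal (9 * pi) * ennreal B" .
  have inb: "norm (a - p) \<le> 4 * r" "norm (b - p) \<le> 4 * r" using a b r by auto
  have "a \<in> \<Omega>" "b \<in> \<Omega>" using inb by (auto intro!: subsetD[OF sub] simp: dist_norm norm_minus_commute)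
  then have "ereal (- A) \<le> 0" "ereal (- B) \<le> 0" using a(2) b(2) nu nv by (meson order_trans)+
  then have AB: "0 \<le> A" "0 \<le> B" by (simp_all add: zero_ereal_def)
  have "ennreal (pi * k + 8 * pi * m) \<le> ennreal (pi * A + 9 * pi * B)"
    using * AB by (simp add: ennreal_plus ennreal_mult)
  then have "pi * k + 8 * pi * m \<le> pi * A + 9 * pi * B"
    using AB by (subst (asm) ennreal_le_iff) auto
  then have "pi * (k + 8 * m) \<le> pi * (A + 9 * B)" by (simp add: algebra_simps)
  then show ?thesis by simp
qed

text \<open>
  The largest \<^term>\<open>\<mu>\<close> in \<^term>\<open>{0..\<nu>}\<close> for which $u \le \mu\log(|z-p|/R)$; this is the
  Lelong number of \<^term>\<open>u\<close> at \<^term>\<open>p\<close>, cut off at \<^term>\<open>\<nu>\<close>. The last conclusion is its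
  maximality in the form in which it is used: by the annulus bound, an exponent that is too large is
  violated on every sufficiently small sphere, and not only along a sequence of radii. Hence two
  functions can be compared at the same radius.
\<close>
lemma plurisubharmonic_max_exponent:
  fixes u :: "complex ^ 'n \<Rightarrow> ereal"
  assumes u: "plurisubharmonic_on \<Omega> u" and neg: "\<And>z. z \<in> \<Omega> \<Longrightarrow> u z \<le> 0"
    and sub: "cball p R \<subseteq> \<Omega>" and R: "0 < R" and \<nu>: "0 \<le> \<nu>"
  obtains \<mu> where "0 \<le> \<mu>" "\<mu> \<le> \<nu>"
    and "\<And>z. z \<noteq> p \<Longrightarrow> norm (z - p) \<le> R \<Longrightarrow> u z \<le> ereal (\<mu> * ln (norm (z - p) / R))"
    and "\<And>t. \<mu> < t \<Longrightarrow> t \<le> \<nu> \<Longrightarrow>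
      \<exists>r>0. \<forall>s. 0 < s \<and> s \<le> r \<longrightarrow> (\<exists>a. norm (a - p) = s \<and> ereal (t * ln (s / R)) \<le> u a)"
proof -
  define bd where "bd t \<longleftrightarrow> (\<forall>z. z \<noteq> p \<longrightarrow> norm (z - p) \<le> R \<longrightarrow> u z \<le> ereal (t * ln (norm (z - p) / R)))" for t
  define T where "T = {t \<in> {0..\<nu>}. bd t}"
  have "bd 0"
    unfolding bd_def
  proof (intro allI impI)
    fix z assume "norm (z - p) \<le> R"
    then have "z \<in> \<Omega>" by (intro subsetD[OF sub]) (simp add: dist_norm norm_minus_commute)
    then show "u z \<le> ereal (0 * ln (norm (z - p) / R))" using neg by (simp add: zero_ereal_def)
  qed
  then have T0: "0 \<in> T" using \<nu> by (simp add: T_def)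
  have bdd: "bdd_above T" by (auto simp: T_def intro: bdd_aboveI[of _ \<nu>])
  define \<mu> where "\<mu> = Sup T"
  have \<mu>0: "0 \<le> \<mu>" unfolding \<mu>_def using T0 bdd by (rule cSup_upper)
  have \<mu>\<nu>: "\<mu> \<le> \<nu>" unfolding \<mu>_def using T0 by (intro cSup_least) (auto simp: T_def)
  have bd\<mu>: "bd \<mu>"
  proof (cases "\<mu> = 0")
    case True then show ?thesis using \<open>bd 0\<close> by simp
  next
    case False
    show ?thesis
      unfolding bd_def
    proof (intro allI impI)
      fix z assume z: "z \<noteq> p" "norm (z - p) \<le> R"
      have x: "ln (norm (z - p) / R) \<le> 0" using z by (intro ln_ratio_nonpos) auto
      show "u z \<le> ereal (\<mu> * ln (norm (z - p) / R))"
      proof (rule ereal_le_mult_limit[OF x])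
        show "0 < \<mu>" using False \<mu>0 by simp
        fix s assume s: "0 \<le> s" "s < \<mu>"
        then obtain t where t: "t \<in> T" "s < t" using less_cSup_iff[OF _ bdd] T0 unfolding \<mu>_def by blast
        then have "u z \<le> ereal (t * ln (norm (z - p) / R))" using z by (simp add: T_def bd_def)
        also have "\<dots> \<le> ereal (s * ln (norm (z - p) / R))" using t x by (simp add: mult_right_mono_neg)
        finally show "u z \<le> ereal (s * ln (norm (z - p) / R))" .
      qed
    qed
  qed
  show ?thesis
  proof (rule that[OF \<mu>0 \<mu>\<nu>])
    show "u z \<le> ereal (\<mu> * ln (norm (z - p) / R))" if "z \<noteq> p" "norm (z - p) \<le> R" for z
      using bd\<mu> that by (simp add: bd_def)
    fix t assume t: "\<mu> < t" "t \<le> \<nu>"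
    have t0: "0 \<le> t" using t \<mu>0 by simp
    have "t \<notin> T" using t bdd cSup_upper unfolding \<mu>_def by fastforce
    then obtain z where z: "z \<noteq> p" "norm (z - p) \<le> R" "\<not> u z \<le> ereal (t * ln (norm (z - p) / R))"
      using t t0 by (auto simp: T_def bd_def)
    show "\<exists>r>0. \<forall>s. 0 < s \<and> s \<le> r \<longrightarrow> (\<exists>a. norm (a - p) = s \<and> ereal (t * ln (s / R)) \<le> u a)"
    proof (intro exI[of _ "norm (z - p)"] conjI allI impI)
      show "0 < norm (z - p)" using z by simp
      fix s assume s: "0 < s \<and> s \<le> norm (z - p)"
      show "\<exists>a. norm (a - p) = s \<and> ereal (t * ln (s / R)) \<le> u a"
      proof (rule ccontr)
        assume "\<not> ?thesis"
        then have "\<And>a. norm (a - p) = s \<Longrightarrow> u a \<le> ereal (t * ln (s / R))" by (metis linear)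
        then have "u z \<le> ereal (t * ln (norm (z - p) / R))"
          using s z by (intro plurisubharmonic_annulus_bound[OF u neg sub _ t0, of s]) auto
        then show False using z by simp
      qed
    qed
  qed
qed

text \<open>
  Let \<^term>\<open>\<mu>\<close> and \<^term>\<open>\<sigma>\<close> be the maximal exponents of \<^term>\<open>u\<close> and \<^term>\<open>v\<close>. The
  claim is that their sum is at least \<^term>\<open>\<nu>\<close>. Otherwise, on all small spheres of radius
  \<^term>\<open>r\<close> there are points \<^term>\<open>a\<close> and \<^term>\<open>b\<close> at which \<^term>\<open>u\<close> and \<^term>\<open>v\<close>
  almost attain their upper bounds, and the two-disc inequality, divided by $\log(R/r)$, gives
  $\nu + 8\sigma \le t + 9s$ in the limit for \<^term>\<open>t\<close> and \<^term>\<open>s\<close> as close to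
  \<^term>\<open>\<mu>\<close> and \<^term>\<open>\<sigma>\<close> as desired.
\<close>
lemma plurisubharmonic_pole_split:
  fixes u v :: "complex ^ 'n \<Rightarrow> ereal"
  assumes u: "plurisubharmonic_on \<Omega> u" and nu: "\<And>z. z \<in> \<Omega> \<Longrightarrow> u z \<le> 0"
    and v: "plurisubharmonic_on \<Omega> v" and nv: "\<And>z. z \<in> \<Omega> \<Longrightarrow> v z \<le> 0"
    and sub: "cball p R \<subseteq> \<Omega>" and R: "0 < R" and \<nu>: "0 \<le> \<nu>"
    and uv: "\<And>z. z \<noteq> p \<Longrightarrow> norm (z - p) \<le> R \<Longrightarrow> u z + v z \<le> ereal (\<nu> * ln (norm (z - p) / R))"
  obtains \<mu> where "0 \<le> \<mu>" "\<mu> \<le> \<nu>"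
    and "\<And>z. z \<noteq> p \<Longrightarrow> norm (z - p) \<le> R \<Longrightarrow> u z \<le> ereal (\<mu> * ln (norm (z - p) / R))"
    and "\<And>z. z \<noteq> p \<Longrightarrow> norm (z - p) \<le> R \<Longrightarrow> v z \<le> ereal ((\<nu> - \<mu>) * ln (norm (z - p) / R))"
proof -
  obtain \<mu> where \<mu>: "0 \<le> \<mu>" "\<mu> \<le> \<nu>"
    and u\<mu>: "\<And>z. z \<noteq> p \<Longrightarrow> norm (z - p) \<le> R \<Longrightarrow> u z \<le> ereal (\<mu> * ln (norm (z - p) / R))"
    and u_sharp: "\<And>t. \<mu> < t \<Longrightarrow> t \<le> \<nu> \<Longrightarrow>
      \<exists>r>0. \<forall>s. 0 < s \<and> s \<le> r \<longrightarrow> (\<exists>a. norm (a - p) = s \<and> ereal (t * ln (s / R)) \<le> u a)"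
    using plurisubharmonic_max_exponent[OF u nu sub R \<nu>] by blast
  obtain \<sigma> where \<sigma>: "0 \<le> \<sigma>" "\<sigma> \<le> \<nu>"
    and v\<sigma>: "\<And>z. z \<noteq> p \<Longrightarrow> norm (z - p) \<le> R \<Longrightarrow> v z \<le> ereal (\<sigma> * ln (norm (z - p) / R))"
    and v_sharp: "\<And>t. \<sigma> < t \<Longrightarrow> t \<le> \<nu> \<Longrightarrow>
      \<exists>r>0. \<forall>s. 0 < s \<and> s \<le> r \<longrightarrow> (\<exists>a. norm (a - p) = s \<and> ereal (t * ln (s / R)) \<le> v a)"
    using plurisubharmonic_max_exponent[OF v nv sub R \<nu>] by blast
  have sum: "\<nu> \<le> \<mu> + \<sigma>"
  proof (rule ccontr)
    assume "\<not> ?thesis"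
    define \<delta> where "\<delta> = \<nu> - \<mu> - \<sigma>"
    have \<delta>: "0 < \<delta>" using \<open>\<not> \<nu> \<le> \<mu> + \<sigma>\<close> by (simp add: \<delta>_def)
    define t s where "t = \<mu> + \<delta> / 20" and "s = \<sigma> + \<delta> / 40"
    have ts: "\<mu> < t" "t \<le> \<nu>" "\<sigma> < s" "s \<le> \<nu>" 
      using \<delta> \<mu> \<sigma> \<delta>_def unfolding t_def s_def by linarith+
    obtain r1 where r1: "0 < r1" "\<And>s. 0 < s \<Longrightarrow> s \<le> r1 \<Longrightarrow> \<exists>a. norm (a - p) = s \<and> ereal (t * ln (s / R)) \<le> u a"
      using u_sharp[OF ts(1,2)] by blast
    obtain r2 where r2: "0 < r2" "\<And>r. 0 < r \<Longrightarrow> r \<le> r2 \<Longrightarrow> \<exists>a. norm (a - p) = r \<and> ereal (s * ln (r / R)) \<le> v a"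
      using v_sharp[OF ts(3,4)] by blast
    \<comment> \<open>The radius is chosen such that $L = \log(R/r) \ge M$. Since $\nu - \mu - \sigma = \delta$, the
      two-disc inequality leaves $\delta L - (\delta/20 + 9\delta/40) L = 29\delta L/40$ on the left,
      against terms that do not depend on $L$; this bounds $L$ by a number below $M$.\<close>
    define M where "M = 2 * (\<nu> + 8 * \<sigma>) * ln 4 / \<delta> + 1"
    define r where "r = min (min r1 r2) (min (R / 4) (R * exp (- M)))"
    have "r \<le> R / 4" by (simp add: r_def min_le_iff_disj)
    then have r: "0 < r" "r \<le> r1" "r \<le> r2" "4 * r \<le> R" "r \<le> R * exp (- M)"
      using r1(1) r2(1) R by (simp_all add: r_def min_le_iff_disj)
    define L where "L = - ln (r / R)"
    have "ln (r / R) \<le> ln (exp (- M))" using r R by (subst ln_le_cancel_iff) (auto simp: pos_divide_le_eq mult.commute)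
    then have LM: "M \<le> L" by (simp add: L_def)
    have ln4r: "ln (4 * r / R) = ln 4 - L" using r R by (simp add: L_def ln_div ln_mult)
    have ln4r_neg: "ln 4 - L \<le> 0" unfolding ln4r[symmetric] using r by (intro ln_ratio_nonpos) auto
    obtain a where a: "norm (a - p) = r" "ereal (t * ln (r / R)) \<le> u a" using r1(2) r by blast
    obtain b where b: "norm (b - p) = r" "ereal (s * ln (r / R)) \<le> v b" using r2(2) r by blast
    have uv_psh: "plurisubharmonic_on \<Omega> (\<lambda>z. u z + v z)" using u v nu nv by (rule plurisubharmonic_on_add)
    have "\<nu> * (L - ln 4) + 8 * (\<sigma> * (L - ln 4)) \<le> t * L + 9 * (s * L)"
    proof (rule plurisubharmonic_two_disc_inequality[OF u nu v nv _ r(1) a(1) _ b(1)])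
      show "cball p (4 * r) \<subseteq> \<Omega>" using sub r by (auto intro!: subsetD[OF sub])
      show "ereal (- (t * L)) \<le> u a" "ereal (- (s * L)) \<le> v b" using a b by (simp_all add: L_def)
      show "0 \<le> \<sigma> * (L - ln 4)" "0 \<le> \<nu> * (L - ln 4)" using \<sigma> \<nu> ln4r_neg by simp_all
      fix z assume z: "norm (z - p) \<le> 4 * r"
      have "v z \<le> ereal (\<sigma> * ln (4 * r / R))"
        by (rule plurisubharmonic_ball_le[OF v nv sub \<sigma>(1) v\<sigma>]) (use r z in auto)
      then show "v z \<le> ereal (- (\<sigma> * (L - ln 4)))" unfolding ln4r by (simp add: algebra_simps)
      have "u z + v z \<le> ereal (\<nu> * ln (4 * r / R))"
        by (rule plurisubharmonic_ball_le[OF uv_psh _ sub \<nu> uv]) (use r z nu nv in \<open>auto intro: add_nonpos_nonpos\<close>)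
      then show "u z + v z \<le> ereal (- (\<nu> * (L - ln 4)))" unfolding ln4r by (simp add: algebra_simps)
    qed
    moreover have "t * L = \<mu> * L + \<delta> * L / 20" "s * L = \<sigma> * L + \<delta> * L / 40"
      by (simp_all add: t_def s_def distrib_right)
    moreover have "\<nu> * (L - ln 4) = \<mu> * L + \<sigma> * L + \<delta> * L - \<nu> * ln 4"
      "\<sigma> * (L - ln 4) = \<sigma> * L - \<sigma> * ln 4"
      "(\<nu> + 8 * \<sigma>) * ln 4 = \<nu> * ln 4 + 8 * (\<sigma> * ln 4)"
      by (simp_all add: \<delta>_def algebra_simps)
    ultimately have "29 * (\<delta> * L) \<le> 40 * ((\<nu> + 8 * \<sigma>) * ln 4)" by linarith
    moreover have "\<delta> * M \<le> \<delta> * L" using LM \<delta> by simp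
    moreover have "\<delta> * M = 2 * ((\<nu> + 8 * \<sigma>) * ln 4) + \<delta>" using \<delta> by (simp add: M_def distrib_left)
    moreover have "0 \<le> (\<nu> + 8 * \<sigma>) * ln (4::real)" using \<nu> \<sigma> by (intro mult_nonneg_nonneg) auto
    ultimately show False using \<delta> by linarith
  qed
  show ?thesis
  proof (rule that[OF \<mu> u\<mu>])
    fix z assume z: "z \<noteq> p" "norm (z - p) \<le> R"
    have "ln (norm (z - p) / R) \<le> 0" using z by (intro ln_ratio_nonpos) auto
    then have "\<sigma> * ln (norm (z - p) / R) \<le> (\<nu> - \<mu>) * ln (norm (z - p) / R)"
      using sum by (intro mult_right_mono_neg) auto
    then show "v z \<le> ereal ((\<nu> - \<mu>) * ln (norm (z - p) / R))"
      using v\<sigma>[OF z] by (meson ereal_less_eq(3) order_trans)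
  qed
qed

section \<open>Green functions and their summands\<close>

text \<open>
  The value of \<^term>\<open>u\<close> at \<^term>\<open>p\<close> is at most its means over small circles, while
  \<^term>\<open>\<phi>\<close> is almost bounded by \<^term>\<open>\<phi> p\<close> there by semicontinuity. This recovers the
  comparison at the poles, where both Green functions may be $-\infty$.
\<close>
lemma plurisubharmonic_le_at_point:
  fixes u \<phi> :: "complex ^ 'n \<Rightarrow> ereal"
  assumes u: "plurisubharmonic_on \<Omega> u" and neg: "\<And>z. z \<in> \<Omega> \<Longrightarrow> u z \<le> 0"
    and \<phi>: "usc_on \<Omega> \<phi>" and \<Omega>: "open \<Omega>" "p \<in> \<Omega>"
    and le: "\<forall>\<^sub>F z in at p. u z \<le> \<phi> z"
  shows "u p \<le> \<phi> p"
proof (rule dense_ge)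
  fix c assume c: "\<phi> p < c"
  show "u p \<le> c"
  proof (cases c)
    case (real x)
    have "\<forall>\<^sub>F z in at p. \<phi> z < c"
      using \<phi> \<Omega> c unfolding usc_on_iff_eventually by (metis at_within_open)
    then have "\<forall>\<^sub>F z in at p. u z \<le> c" using le by eventually_elim auto
    then obtain d where d: "0 < d" "\<And>z. z \<noteq> p \<Longrightarrow> dist z p < d \<Longrightarrow> u z \<le> c"
      unfolding eventually_at by auto
    obtain e where e: "0 < e" "cball p e \<subseteq> \<Omega>" using \<Omega> open_contains_cball by blast
    define r where "r = min e (d / 2)"
    have r: "0 < r" "r \<le> e" "r < d" using d e by (auto simp: r_def)
    have "u p \<le> ereal x"
    proof (rule plurisubharmonic_center_le[OF u neg _ r(1)])
      show "cball p r \<subseteq> \<Omega>" using r e by auto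
      show "u z \<le> ereal x" if "norm (z - p) = r" for z
        using d(2)[of z] that r real by (auto simp: dist_norm)
    qed auto
    then show ?thesis using real by simp
  qed (use c in auto)
qed

lemma green_class_add:
  assumes u: "u \<in> green_class \<Omega> w \<mu>" and v: "v \<in> green_class \<Omega> w \<nu>"
  shows "(\<lambda>z. u z + v z) \<in> green_class \<Omega> w (\<mu> + \<nu>)"
  unfolding green_class_def
proof (intro CollectI conjI ballI allI)
  show "plurisubharmonic_on \<Omega> (\<lambda>z. u z + v z)"
    using u v by (intro plurisubharmonic_on_add) (auto simp: green_class_def)
  show "u z + v z \<le> 0" if "z \<in> \<Omega>" for z
    using u v that by (auto simp: green_class_def intro: add_nonpos_nonpos)
  fix j
  obtain C C' where C: "\<forall>\<^sub>F \<zeta> in at (w j). u \<zeta> - ereal (\<mu> $ j * ln (norm (\<zeta> - w j))) \<le> ereal C"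
      "\<forall>\<^sub>F \<zeta> in at (w j). v \<zeta> - ereal (\<nu> $ j * ln (norm (\<zeta> - w j))) \<le> ereal C'"
    using u v unfolding green_class_def by blast
  have "\<forall>\<^sub>F \<zeta> in at (w j). u \<zeta> + v \<zeta> - ereal ((\<mu> + \<nu>) $ j * ln (norm (\<zeta> - w j))) \<le> ereal (C + C')"
    using C
  proof eventually_elim
    case (elim \<zeta>)
    then show ?case
      by (cases "u \<zeta>"; cases "v \<zeta>") (auto simp: algebra_simps)
  qed
  then show "\<exists>C. \<forall>\<^sub>F \<zeta> in at (w j). u \<zeta> + v \<zeta> - ereal ((\<mu> + \<nu>) $ j * ln (norm (\<zeta> - w j))) \<le> ereal C" by blast
qed

lemma pluricomplex_green_upper: "u \<in> green_class \<Omega> w \<nu> \<Longrightarrow> u z \<le> pluricomplex_green \<Omega> w \<nu> z"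
  unfolding pluricomplex_green_def by (rule SUP_upper)

lemma eventually_in_domain_off_poles:
  fixes w :: "'k::finite \<Rightarrow> complex ^ 'n"
  assumes "open \<Omega>" "p \<in> \<Omega>"
  shows "\<forall>\<^sub>F z in at p. z \<in> \<Omega> \<and> z \<notin> range w"
proof -
  have "open (\<Omega> - (range w - {p}))" using assms(1) by (intro open_Diff finite_imp_closed) auto
  moreover have "p \<in> \<Omega> - (range w - {p})" using assms(2) by simp
  ultimately have "\<forall>\<^sub>F z in at p. z \<in> \<Omega> - (range w - {p})" by (rule eventually_at_in_open')
  moreover have "\<forall>\<^sub>F z in at p. z \<noteq> p" by (simp add: eventually_at_filter)
  ultimately show ?thesis by eventually_elim auto
qed

text \<open>
  The sum of the functions $\nu_j\log(|z-w_j|/D)$, with \<^term>\<open>D\<close> exceeding the diameter of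
  \<^term>\<open>\<Omega>\<close>, is a competitor with finite values away from the poles.
\<close>
lemma pluricomplex_green_finite:
  fixes w :: "'k::finite \<Rightarrow> complex ^ 'n"
  assumes bdd: "bounded \<Omega>" and w: "range w \<subseteq> \<Omega>" and \<Omega>: "open \<Omega>" and \<nu>: "0 \<le> \<nu>" and z: "z \<notin> range w"
  shows "- \<infinity> < pluricomplex_green \<Omega> w \<nu> z"
proof -
  obtain B where B: "\<And>x. x \<in> \<Omega> \<Longrightarrow> norm x \<le> B" using bdd by (auto simp: bounded_iff)
  define D where "D = 2 * \<bar>B\<bar> + 1"
  have D: "0 < D" by (simp add: D_def)
  have le: "norm (x - w j) \<le> D" if "x \<in> \<Omega>" for x j
  proof -
    have "norm x \<le> B" "norm (w j) \<le> B" using B that w by auto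
    then show ?thesis using norm_triangle_ineq4[of x "w j"] by (simp add: D_def)
  qed
  have \<nu>j: "0 \<le> \<nu> $ j" for j using \<nu> by (simp add: less_eq_vec_def)
  have np: "log_pole (\<nu> $ j) D (w j) x \<le> 0" if "x \<in> \<Omega>" for x j
    by (rule log_pole_nonpos[OF \<nu>j le[OF that]])
  define U where "U x = (\<Sum>j\<in>UNIV. log_pole (\<nu> $ j) D (w j) x)" for x
  have "U \<in> green_class \<Omega> w \<nu>"
    unfolding green_class_def
  proof (intro CollectI conjI ballI allI)
    show "plurisubharmonic_on \<Omega> U"
      unfolding U_def using \<nu>j D le np by (intro plurisubharmonic_on_sum plurisubharmonic_log_pole) auto
    show "U x \<le> 0" if "x \<in> \<Omega>" for x unfolding U_def using np that by (intro sum_nonpos) auto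
    fix j
    have "w j \<in> \<Omega>" using w by auto
    have "\<forall>\<^sub>F \<zeta> in at (w j). U \<zeta> - ereal (\<nu> $ j * ln (norm (\<zeta> - w j))) \<le> ereal (- (\<nu> $ j * ln D))"
      using eventually_in_domain_off_poles[OF \<Omega> \<open>w j \<in> \<Omega>\<close>, of w]
    proof eventually_elim
      case (elim \<zeta>)
      then have nz: "0 < norm (\<zeta> - w j)" by auto
      have "U \<zeta> = log_pole (\<nu> $ j) D (w j) \<zeta> + (\<Sum>i\<in>UNIV - {j}. log_pole (\<nu> $ i) D (w i) \<zeta>)"
        unfolding U_def by (subst sum.remove[of UNIV j]) auto
      also have "\<dots> \<le> log_pole (\<nu> $ j) D (w j) \<zeta> + 0"
        using elim np by (intro add_left_mono sum_nonpos) auto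
      also have "\<dots> = ereal (\<nu> $ j * ln (norm (\<zeta> - w j)) - \<nu> $ j * ln D)"
        using nz D by (auto simp: log_pole_def ln_div right_diff_distrib zero_ereal_def)
      finally show ?case by (cases "U \<zeta>") auto
    qed
    then show "\<exists>C. \<forall>\<^sub>F \<zeta> in at (w j). U \<zeta> - ereal (\<nu> $ j * ln (norm (\<zeta> - w j))) \<le> ereal C" by blast
  qed
  then have "U z \<le> pluricomplex_green \<Omega> w \<nu> z" by (rule pluricomplex_green_upper)
  moreover have "- \<infinity> < U z"
  proof -
    have "log_pole (\<nu> $ j) D (w j) z = ereal (\<nu> $ j * ln (norm (z - w j) / D))" for j
      using z by (auto simp: log_pole_def zero_ereal_def)
    then show ?thesis by (simp add: U_def)
  qed
  ultimately show ?thesis by (rule less_le_trans[rotated])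
qed

lemma pluricomplex_green_pole_bound:
  assumes sub: "cball (w j) R \<subseteq> \<Omega>" and \<nu>: "0 \<le> \<nu>" and z: "z \<noteq> w j" "norm (z - w j) \<le> R"
  shows "pluricomplex_green \<Omega> w \<nu> z \<le> ereal (\<nu> $ j * ln (norm (z - w j) / R))"
  unfolding pluricomplex_green_def
proof (rule SUP_least)
  fix u assume u: "u \<in> green_class \<Omega> w \<nu>"
  then obtain C where "\<forall>\<^sub>F \<zeta> in at (w j). u \<zeta> - ereal (\<nu> $ j * ln (norm (\<zeta> - w j))) \<le> ereal C"
    unfolding green_class_def by blast
  then show "u z \<le> ereal (\<nu> $ j * ln (norm (z - w j) / R))"
    using u \<nu> by (intro plurisubharmonic_pole_bound[OF _ _ sub _ _ z]) (auto simp: green_class_def less_eq_vec_def)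
qed

lemma green_classI:
  fixes w :: "'k::finite \<Rightarrow> complex ^ 'n" and \<mu> :: "real ^ 'k"
  assumes "plurisubharmonic_on \<Omega> u" "\<And>z. z \<in> \<Omega> \<Longrightarrow> u z \<le> 0" and R: "\<And>j. 0 < R j"
    and bd: "\<And>j z. z \<noteq> w j \<Longrightarrow> norm (z - w j) \<le> R j \<Longrightarrow> u z \<le> ereal (\<mu> $ j * ln (norm (z - w j) / R j))"
  shows "u \<in> green_class \<Omega> w \<mu>"
  unfolding green_class_def
proof (intro CollectI conjI ballI allI assms(1,2))
  fix j
  have "\<forall>\<^sub>F \<zeta> in at (w j). u \<zeta> - ereal (\<mu> $ j * ln (norm (\<zeta> - w j))) \<le> ereal (- (\<mu> $ j * ln (R j)))"
    unfolding eventually_at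
  proof (intro exI[of _ "R j"] conjI R ballI impI)
    fix \<zeta> assume \<zeta>: "\<zeta> \<noteq> w j \<and> dist \<zeta> (w j) < R j"
    then have nz: "0 < norm (\<zeta> - w j)" by simp
    have "u \<zeta> \<le> ereal (\<mu> $ j * ln (norm (\<zeta> - w j) / R j))" using bd[of \<zeta> j] \<zeta> by (simp add: dist_norm)
    also have "\<dots> = ereal (\<mu> $ j * ln (norm (\<zeta> - w j)) - \<mu> $ j * ln (R j))"
      using nz R[of j] by (simp add: ln_div right_diff_distrib)
    finally show "u \<zeta> - ereal (\<mu> $ j * ln (norm (\<zeta> - w j))) \<le> ereal (- (\<mu> $ j * ln (R j)))"
      by (cases "u \<zeta>") auto
  qed
  then show "\<exists>C. \<forall>\<^sub>F \<zeta> in at (w j). u \<zeta> - ereal (\<mu> $ j * ln (norm (\<zeta> - w j))) \<le> ereal C" by blast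
qed

text \<open>
  If \<^term>\<open>u\<close> competes with \<^term>\<open>\<phi>\<close> for the weights \<^term>\<open>\<mu>\<close>, then the sum of
  \<^term>\<open>u\<close> and \<^term>\<open>\<psi>\<close> competes for the total weights, so it is at most the sum of
  \<^term>\<open>\<phi>\<close> and \<^term>\<open>\<psi>\<close>. Where this sum is finite, \<^term>\<open>\<psi>\<close> can be cancelled.
\<close>
lemma green_summand_eq:
  fixes w :: "'k::finite \<Rightarrow> complex ^ 'n"
  assumes \<Omega>: "open \<Omega>" and \<phi>: "\<phi> \<in> green_class \<Omega> w \<mu>" and \<psi>: "\<psi> \<in> green_class \<Omega> w \<mu>'"
    and sum: "\<And>z. z \<in> \<Omega> \<Longrightarrow> pluricomplex_green \<Omega> w (\<mu> + \<mu>') z = \<phi> z + \<psi> z"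
    and fin: "\<And>z. z \<notin> range w \<Longrightarrow> - \<infinity> < pluricomplex_green \<Omega> w (\<mu> + \<mu>') z"
    and z: "z \<in> \<Omega>"
  shows "\<phi> z = pluricomplex_green \<Omega> w \<mu> z"
proof (rule antisym)
  show "\<phi> z \<le> pluricomplex_green \<Omega> w \<mu> z" using \<phi> by (rule pluricomplex_green_upper)
  show "pluricomplex_green \<Omega> w \<mu> z \<le> \<phi> z"
    unfolding pluricomplex_green_def
  proof (rule SUP_least)
    fix u assume u: "u \<in> green_class \<Omega> w \<mu>"
    have off: "u y \<le> \<phi> y" if y: "y \<in> \<Omega>" "y \<notin> range w" for y
    proof -
      have "u y + \<psi> y \<le> \<phi> y + \<psi> y"
        using pluricomplex_green_upper[OF green_class_add[OF u \<psi>], of y] sum[OF y(1)] by simp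
      moreover have "- \<infinity> < \<phi> y + \<psi> y" using fin[OF y(2)] sum[OF y(1)] by simp
      moreover have "\<phi> y \<le> 0" "\<psi> y \<le> 0" using \<phi> \<psi> y by (auto simp: green_class_def)
      ultimately show ?thesis by (cases "u y"; cases "\<phi> y"; cases "\<psi> y") auto
    qed
    show "u z \<le> \<phi> z"
    proof (rule plurisubharmonic_le_at_point[OF _ _ _ \<Omega> z])
      show "plurisubharmonic_on \<Omega> u" "\<And>z. z \<in> \<Omega> \<Longrightarrow> u z \<le> 0" "usc_on \<Omega> \<phi>"
        using u \<phi> by (auto simp: green_class_def plurisubharmonic_on_def)
      show "\<forall>\<^sub>F y in at z. u y \<le> \<phi> y"
        using eventually_in_domain_off_poles[OF \<Omega> z, of w] by eventually_elim (use off in blast)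
    qed
  qed
qed

theorem proposition2p3:
  fixes \<Omega> :: "(complex ^ 'n) set"
    and w :: "'k::finite \<Rightarrow> complex ^ 'n"
    and \<nu> :: "real ^ 'k"
    and \<phi>\<^sub>1 \<phi>\<^sub>2 :: "complex ^ 'n \<Rightarrow> ereal"
  assumes "bounded_hyperconvex_domain \<Omega>"
    and "inj w" and "range w \<subseteq> \<Omega>"
    and "0 \<le> \<nu>"
    and "plurisubharmonic_on \<Omega> \<phi>\<^sub>1" and "\<forall>z\<in>\<Omega>. \<phi>\<^sub>1 z \<le> 0"
    and "plurisubharmonic_on \<Omega> \<phi>\<^sub>2" and "\<forall>z\<in>\<Omega>. \<phi>\<^sub>2 z \<le> 0"
    and "\<forall>z\<in>\<Omega>. pluricomplex_green \<Omega> w \<nu> z = \<phi>\<^sub>1 z + \<phi>\<^sub>2 z"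
  shows "\<exists>\<mu> :: real ^ 'k. 0 \<le> \<mu> \<and> \<mu> \<le> \<nu> \<and>
           (\<forall>z\<in>\<Omega>. \<phi>\<^sub>1 z = pluricomplex_green \<Omega> w \<mu> z) \<and>
           (\<forall>z\<in>\<Omega>. \<phi>\<^sub>2 z = pluricomplex_green \<Omega> w (\<nu> - \<mu>) z)"
proof -
  have \<Omega>: "open \<Omega>" "bounded \<Omega>" using assms(1) by (auto simp: bounded_hyperconvex_domain_def)
  have neg: "\<And>z. z \<in> \<Omega> \<Longrightarrow> \<phi>\<^sub>1 z \<le> 0" "\<And>z. z \<in> \<Omega> \<Longrightarrow> \<phi>\<^sub>2 z \<le> 0" using assms by auto
  have "\<exists>R>0. cball (w j) R \<subseteq> \<Omega>" for j
    using \<Omega>(1) assms(3) unfolding open_contains_cball by blast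
  then obtain R where R: "\<And>j. 0 < R j" "\<And>j. cball (w j) (R j) \<subseteq> \<Omega>" by metis
  have "\<exists>t. 0 \<le> t \<and> t \<le> \<nu> $ j
      \<and> (\<forall>z. z \<noteq> w j \<longrightarrow> norm (z - w j) \<le> R j \<longrightarrow> \<phi>\<^sub>1 z \<le> ereal (t * ln (norm (z - w j) / R j)))
      \<and> (\<forall>z. z \<noteq> w j \<longrightarrow> norm (z - w j) \<le> R j \<longrightarrow> \<phi>\<^sub>2 z \<le> ereal ((\<nu> $ j - t) * ln (norm (z - w j) / R j)))" for j
  proof -
    have "\<phi>\<^sub>1 z + \<phi>\<^sub>2 z \<le> ereal (\<nu> $ j * ln (norm (z - w j) / R j))" if z: "z \<noteq> w j" "norm (z - w j) \<le> R j" for z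
    proof -
      have "z \<in> \<Omega>" using z by (intro subsetD[OF R(2)]) (simp add: dist_norm norm_minus_commute)
      then show ?thesis
        using pluricomplex_green_pole_bound[where w = w and j = j, OF R(2) assms(4) z] assms(9) by simp
    qed
    moreover have "0 \<le> \<nu> $ j" using assms(4) by (simp add: less_eq_vec_def)
    ultimately obtain t where "0 \<le> t" "t \<le> \<nu> $ j"
      "\<And>z. z \<noteq> w j \<Longrightarrow> norm (z - w j) \<le> R j \<Longrightarrow> \<phi>\<^sub>1 z \<le> ereal (t * ln (norm (z - w j) / R j))"
      "\<And>z. z \<noteq> w j \<Longrightarrow> norm (z - w j) \<le> R j \<Longrightarrow> \<phi>\<^sub>2 z \<le> ereal ((\<nu> $ j - t) * ln (norm (z - w j) / R j))"
      using plurisubharmonic_pole_split[OF assms(5) neg(1) assms(7) neg(2) R(2) R(1)] by blast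
    then show ?thesis by blast
  qed
  then obtain m where m: "\<And>j. 0 \<le> m j" "\<And>j. m j \<le> \<nu> $ j"
    "\<And>j z. z \<noteq> w j \<Longrightarrow> norm (z - w j) \<le> R j \<Longrightarrow> \<phi>\<^sub>1 z \<le> ereal (m j * ln (norm (z - w j) / R j))"
    "\<And>j z. z \<noteq> w j \<Longrightarrow> norm (z - w j) \<le> R j \<Longrightarrow> \<phi>\<^sub>2 z \<le> ereal ((\<nu> $ j - m j) * ln (norm (z - w j) / R j))"
    by metis
  define \<mu> where "\<mu> = (\<chi> j. m j)"
  have c1: "\<phi>\<^sub>1 \<in> green_class \<Omega> w \<mu>"
    by (rule green_classI[OF assms(5) neg(1) R(1)]) (use m in \<open>auto simp: \<mu>_def\<close>)
  have c2: "\<phi>\<^sub>2 \<in> green_class \<Omega> w (\<nu> - \<mu>)"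
    by (rule green_classI[OF assms(7) neg(2) R(1)]) (use m in \<open>auto simp: \<mu>_def\<close>)
  note fin = pluricomplex_green_finite[OF \<Omega>(2) assms(3) \<Omega>(1) assms(4)]
  have "\<phi>\<^sub>1 z = pluricomplex_green \<Omega> w \<mu> z" if "z \<in> \<Omega>" for z
    by (rule green_summand_eq[OF \<Omega>(1) c1 c2 _ _ that]) (use assms(9) fin in auto)
  moreover have "\<phi>\<^sub>2 z = pluricomplex_green \<Omega> w (\<nu> - \<mu>) z" if "z \<in> \<Omega>" for z
    by (rule green_summand_eq[OF \<Omega>(1) c2 c1 _ _ that]) (use assms(9) fin in \<open>auto simp: add.commute\<close>)
  moreover have "0 \<le> \<mu>" "\<mu> \<le> \<nu>" using m by (auto simp: \<mu>_def less_eq_vec_def)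
  ultimately show ?thesis by blast
qed

end
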